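(* Let $(H,d)$ be a Hadamard space, let $(X_n)_{n\ge1}$ be a sequence of independent $H$-valued random variables with $\mathbb{E}(X_n)=\mu_n$, and let $\mu\in H$ be such that $$\frac1n\sum_{k=1}^n d(\mu_k,\mu)=O(n^{-p})$$ for some $p>\frac12$. If there exist $z\in H$, $C>0$ and $0\le q<\min\{\frac14,\,p-\frac12\}$ such that for all $n\ge1$ $$\mathbb{P}\Bigl(\max_{1\le k\le n}d(X_k,z)\le Cn^q\Bigr)=1,$$ then $S_n\to\mu$ almost surely, where $S_n$ is the inductive mean of $X_1,\dots,X_n$.
   Context: A Hadamard space is a complete metric space $(H,d)$ such that for all $x,y\in H$ there is $m\in H$ with $d(z,m)^2\le\frac12 d(z,x)^2+\frac12 d(z,y)^2-\frac14 d(x,y)^2$ for all $z\in H$. Any two points $x,y\in H$ are joined by a unique minimal geodesic, i.e. a map $\gamma:[0,1]\to H$ with $\gamma(0)=x$, $\gamma(1)=y$, $d(\gamma(s),\gamma(t))=|t-s|\,d(x,y)$; write $x\oplus_t y=\gamma(t)$. The inductive mean of $x_1,x_2,\dots$ is defined by $S_1=x_1$, $S_{n+1}=S_n\oplus_{\frac1{n+1}}x_{n+1}$ (applied pointwise to random variables). A random variable in $H$ is a Borel measurable map from a probability space to $H$. For $X$ with $\mathbb{E}(d(X,z)^2)<\infty$ for some (equivalently all) $z\in H$, the expectation $\mathbb{E}(X)\in H$ is the unique minimizer of $z\mapsto\mathbb{E}(d(X,z)^2)$ over $H$.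
   Formalization: Each random variable X_n is additionally assumed to take values almost surely in a separable subset of H (automatic for separable H); without this the claim fails if a two-valued measurable cardinal exists. *)

theory Defs
  imports "HOL-Probability.Probability" "HOL-Library.Landau_Symbols"
begin

class hadamard_space = complete_space +
  assumes ex_hadamard_midpoint:
    "\<exists>m. \<forall>z. (dist z m)\<^sup>2 \<le> (dist z x)\<^sup>2 / 2 + (dist z y)\<^sup>2 / 2 - (dist x y)\<^sup>2 / 4"

definition minimal_geodesic :: "(real \<Rightarrow> 'a::metric_space) \<Rightarrow> 'a \<Rightarrow> 'a \<Rightarrow> bool" where
  "minimal_geodesic \<gamma> x y \<longleftrightarrow> \<gamma> 0 = x \<and> \<gamma> 1 = y \<and>
     (\<forall>s\<in>{0..1}. \<forall>t\<in>{0..1}. dist (\<gamma> s) (\<gamma> t) = \<bar>t - s\<bar> * dist x y)"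

(* The description is on the point rather than on the geodesic: as a function on all of real,
   a minimal geodesic is determined on [0,1] only.  Meaningful for t in [0,1]. *)
definition geodesic_point :: "'a::hadamard_space \<Rightarrow> real \<Rightarrow> 'a \<Rightarrow> 'a" where
  "geodesic_point x t y = (THE p. \<exists>\<gamma>. minimal_geodesic \<gamma> x y \<and> \<gamma> t = p)"

(* Sequences are indexed from 1; the value at 0 is irrelevant. *)
fun inductive_mean :: "(nat \<Rightarrow> 'a::hadamard_space) \<Rightarrow> nat \<Rightarrow> 'a" where
  "inductive_mean x 0 = undefined"
| "inductive_mean x (Suc 0) = x 1"
| "inductive_mean x (Suc (Suc n)) =
     geodesic_point (inductive_mean x (Suc n)) (1 / real (Suc (Suc n))) (x (Suc (Suc n)))"

definition square_integrable :: "'b measure \<Rightarrow> ('b \<Rightarrow> 'a::metric_space) \<Rightarrow> bool" where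
  "square_integrable M X \<longleftrightarrow> X \<in> borel_measurable M \<and>
     (\<exists>z. integrable M (\<lambda>\<omega>. (dist (X \<omega>) z)\<^sup>2))"

(* Meaningful for square integrable X, where the minimizer exists and is unique. *)
definition hadamard_expectation :: "'b measure \<Rightarrow> ('b \<Rightarrow> 'a::hadamard_space) \<Rightarrow> 'a" where
  "hadamard_expectation M X =
     (THE m. \<forall>z. (\<integral>\<omega>. (dist (X \<omega>) m)\<^sup>2 \<partial>M) \<le> (\<integral>\<omega>. (dist (X \<omega>) z)\<^sup>2 \<partial>M))"

(* The law of X has separable support.  This is automatic if the space is separable, and for
   arbitrary metric spaces it can fail only if there are real-valued measurable cardinals.  If
   there is a two-valued measurable cardinal, the law of large numbers is false without it: take
   a tree made of that many unit segments glued at a point, and for X the endpoint of a segment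
   chosen by a two-valued measure; then the sequence X, X, X, ... is independent and its inductive
   means are all X, whereas the expectation of X is the glueing point. *)
definition separably_valued :: "'b measure \<Rightarrow> ('b \<Rightarrow> 'a::metric_space) \<Rightarrow> bool" where
  "separably_valued M X \<longleftrightarrow> (\<exists>D. countable D \<and> (AE \<omega> in M. X \<omega> \<in> closure D))"

end

theory Submission
  imports Defs "HOL-Library.Discrete_Functions"
begin

text \<open>The proof is the second moment method for the strong law, with the variance inequality of
  Hadamard spaces in place of orthogonality.

  Points on geodesics and expectations both minimize functions that are strongly convex along
  midpoints, and a minimizer \<open>m\<close> of such an \<open>F\<close> satisfies
  \<open>F m + (dist x m)\<^sup>2 \<le> F x\<close>. For geodesics this is the comparison inequality
  \<open>geodesic_point_npc\<close>, for expectations it is \<open>variance_inequality\<close>. Since \<open>S\<^sub>n\<close> and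
  \<open>X\<^sub>n\<^sub>+\<^sub>1\<close> are independent, the two combine to a recursion for the second moments
  \<open>e\<^sub>n\<close> of the distance from \<open>S\<^sub>n\<close> to \<open>\<mu>\<close>. If the distances from the variables to
  \<open>\<mu>\<close> are bounded by \<open>K * n powr q\<close> and \<open>\<delta>\<^sub>n\<close> denotes the distance from
  \<open>\<mu>\<^sub>n\<close> to \<open>\<mu>\<close>, then \<open>n\<^sup>2 * e\<^sub>n\<close> grows in each step by at most
  \<open>4 * K * n powr (1 + q) * \<delta>\<^sub>n + K\<^sup>2 * n powr (2 * q)\<close> (\<open>expected_square_dist_step\<close>,
  \<open>second_moment_inductive_mean\<close>). Summation and the assumption on the averages of the
  \<open>\<delta>\<^sub>n\<close> give \<open>e\<^sub>n = O(n powr (q - p) + n powr (2 * q - 1))\<close>.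

  Both exponents are below \<open>- 1 / 2\<close>, so the second moments are summable along the squares
  \<open>n = k\<^sup>2\<close>, and the means converge almost surely along the squares. Between consecutive squares
  the means move by \<open>O(k powr (2 * q - 1))\<close> only, which tends to zero.

  Independence of \<open>S\<^sub>n\<close> and \<open>X\<^sub>n\<^sub>+\<^sub>1\<close>, and already measurability of \<open>S\<^sub>n\<close>, rests
  on the separability of the ranges. The general case is therefore reduced to variables with values
  in a separable closed set, by a change on a null set.\<close>

section \<open>Strong convexity in Hadamard spaces\<close>

text \<open>Both kinds of minimizers that matter below, points on geodesics and expectations, minimize
  averages of squared distances. By the axiom of Hadamard spaces each squared distance
  \<open>(dist z _)\<^sup>2\<close> satisfies the inequality in this definition, and averaging preserves it.
  The modulus is the best possible one: in a Euclidean space it holds with equality for squared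
  distances.\<close>
definition strongly_midpoint_convex :: "('a::hadamard_space \<Rightarrow> real) \<Rightarrow> bool" where
  "strongly_midpoint_convex F \<longleftrightarrow> (\<forall>x y m.
     (\<forall>z. (dist z m)\<^sup>2 \<le> (dist z x)\<^sup>2 / 2 + (dist z y)\<^sup>2 / 2 - (dist x y)\<^sup>2 / 4) \<longrightarrow>
     F m \<le> F x / 2 + F y / 2 - (dist x y)\<^sup>2 / 4)"

lemma midpoint_dist:
  fixes x y m :: "'a::metric_space"
  assumes m: "\<And>z. (dist z m)\<^sup>2 \<le> (dist z x)\<^sup>2 / 2 + (dist z y)\<^sup>2 / 2 - (dist x y)\<^sup>2 / 4"
  shows "dist x m = dist x y / 2"
proof -
  have 1: "(dist x m)\<^sup>2 \<le> (dist x y / 2)\<^sup>2" using m[of x] by (simp add: power_divide)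
  have 2: "(dist y m)\<^sup>2 \<le> (dist x y / 2)\<^sup>2" using m[of y] by (simp add: power_divide dist_commute)
  have "dist x m \<le> dist x y / 2" by (rule power2_le_imp_le[OF 1]) simp
  moreover have "dist y m \<le> dist x y / 2" by (rule power2_le_imp_le[OF 2]) simp
  moreover have "dist x y \<le> dist x m + dist y m" by (rule dist_triangle2)
  ultimately show ?thesis by simp
qed

text \<open>Any two near-minimizers are close, since otherwise the value at their midpoint would fall below
  the infimum. So a minimizing sequence is Cauchy.\<close>
lemma strongly_midpoint_convex_ex_minimizer:
  fixes F :: "'a::hadamard_space \<Rightarrow> real"
  assumes mc: "strongly_midpoint_convex F" and cont: "continuous_on UNIV F" and nonneg: "\<And>x. 0 \<le> F x"
  shows "\<exists>m. \<forall>x. F m \<le> F x"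
proof -
  define I where "I = (INF x. F x)"
  have bdd: "bdd_below (range F)" using nonneg by (auto intro!: bdd_belowI[of _ 0])
  have I_le: "I \<le> F x" for x unfolding I_def by (rule cINF_lower[OF bdd]) simp
  have sq: "(dist x y)\<^sup>2 \<le> 2 * (F x - I) + 2 * (F y - I)" for x y
  proof -
    obtain m where m: "\<And>z. (dist z m)\<^sup>2 \<le> (dist z x)\<^sup>2 / 2 + (dist z y)\<^sup>2 / 2 - (dist x y)\<^sup>2 / 4"
      using ex_hadamard_midpoint by metis
    have "F m \<le> F x / 2 + F y / 2 - (dist x y)\<^sup>2 / 4"
      using mc m unfolding strongly_midpoint_convex_def by blast
    with I_le[of m] show ?thesis by simp
  qed
  have "\<exists>x. F x < I + 1 / real (Suc n)" for n
  proof -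
    have "(INF x. F x) < I + 1 / real (Suc n)" by (simp add: I_def)
    then show ?thesis using cINF_less_iff[OF _ bdd, of "I + 1 / real (Suc n)"] by auto
  qed
  then obtain u where u: "\<And>n. F (u n) < I + 1 / real (Suc n)" by metis
  have "Cauchy u"
  proof (rule metric_CauchyI)
    fix e :: real assume "0 < e"
    then obtain N where N: "1 / real (Suc N) < e\<^sup>2 / 4"
      using nat_approx_posE[of "e\<^sup>2 / 4"] by auto
    show "\<exists>M. \<forall>m\<ge>M. \<forall>n\<ge>M. dist (u m) (u n) < e"
    proof (intro exI allI impI)
      have gap: "F (u k) - I < e\<^sup>2 / 4" if "N \<le> k" for k
      proof -
        have "1 / real (Suc k) \<le> 1 / real (Suc N)" using that by (intro divide_left_mono) auto
        with u[of k] N show ?thesis by simp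
      qed
      fix m n assume "N \<le> m" "N \<le> n"
      then have "(dist (u m) (u n))\<^sup>2 < e\<^sup>2"
        using sq[of "u m" "u n"] gap[of m] gap[of n] by simp
      then show "dist (u m) (u n) < e" using \<open>0 < e\<close> by (simp add: power_less_imp_less_base)
    qed
  qed
  then obtain l where l: "u \<longlonglongrightarrow> l" by (auto simp: Cauchy_convergent_iff convergent_def)
  have "(\<lambda>n. F (u n)) \<longlonglongrightarrow> F l"
    using continuous_on_tendsto_compose[OF cont l] by simp
  moreover have "(\<lambda>n. I + 1 / real (Suc n)) \<longlonglongrightarrow> I + 0"
    by (intro tendsto_intros LIMSEQ_Suc[OF lim_1_over_n])
  ultimately have "F l \<le> I + 0"
    by (rule LIMSEQ_le) (use u in \<open>auto intro!: exI[of _ 0] less_imp_le\<close>)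
  then show ?thesis using I_le by (metis add.right_neutral order_trans)
qed

text \<open>Applying the definition once, to \<open>m\<close> and \<open>x\<close>, gives only half of the squared distance.
  If \<open>F m + c * (dist x m)\<^sup>2 \<le> F x\<close> holds for all \<open>x\<close>, then using this at the midpoint
  improves \<open>c\<close> to \<open>(c + 1) / 2\<close>, and iteration from \<open>c = 0\<close> gives the
  constant 1. It is this constant that produces the coefficient \<open>(1 - t)\<^sup>2\<close> in the recursion
  for the second moments.\<close>
lemma strongly_midpoint_convex_growth:
  fixes F :: "'a::hadamard_space \<Rightarrow> real"
  assumes mc: "strongly_midpoint_convex F" and min: "\<And>x. F m \<le> F x"
  shows "F m + (dist x m)\<^sup>2 \<le> F x"
proof -
  have step: "F m + (1 - (1/2) ^ k) * (dist x m)\<^sup>2 \<le> F x" for k x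
  proof (induction k arbitrary: x)
    case 0 then show ?case using min by simp
  next
    case (Suc k)
    obtain c where c: "\<And>z. (dist z c)\<^sup>2 \<le> (dist z m)\<^sup>2 / 2 + (dist z x)\<^sup>2 / 2 - (dist m x)\<^sup>2 / 4"
      using ex_hadamard_midpoint by metis
    have "F c \<le> F m / 2 + F x / 2 - (dist m x)\<^sup>2 / 4"
      using mc c unfolding strongly_midpoint_convex_def by blast
    moreover have "F m + (1 - (1/2) ^ k) * (dist c m)\<^sup>2 \<le> F c" by (rule Suc)
    moreover have "(1 - (1/2) ^ Suc k) * (dist x m)\<^sup>2
        = 2 * ((1 - (1/2) ^ k) * (dist c m)\<^sup>2) + (dist m x)\<^sup>2 / 2"
      unfolding dist_commute[of c m] midpoint_dist[OF c]
      by (simp add: power_divide dist_commute[of x m] field_simps)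
    ultimately show ?case by linarith
  qed
  have "(\<lambda>k. F m + (1 - (1/2) ^ k) * (dist x m)\<^sup>2) \<longlonglongrightarrow> F m + (1 - 0) * (dist x m)\<^sup>2"
    by (intro tendsto_intros LIMSEQ_power_zero) simp
  then have "F m + (1 - 0) * (dist x m)\<^sup>2 \<le> F x"
    by (rule LIMSEQ_le_const2) (use step in auto)
  then show ?thesis by simp
qed

lemma strongly_midpoint_convex_weighted_dist:
  assumes "0 \<le> t" "t \<le> 1"
  shows "strongly_midpoint_convex (\<lambda>w. (1 - t) * (dist w x)\<^sup>2 + t * (dist w y)\<^sup>2)"
  unfolding strongly_midpoint_convex_def
proof (intro allI impI)
  fix a b m :: 'a
  assume m: "\<forall>z. (dist z m)\<^sup>2 \<le> (dist z a)\<^sup>2 / 2 + (dist z b)\<^sup>2 / 2 - (dist a b)\<^sup>2 / 4"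
  have "(1 - t) * (dist x m)\<^sup>2 \<le> (1 - t) * ((dist x a)\<^sup>2 / 2 + (dist x b)\<^sup>2 / 2 - (dist a b)\<^sup>2 / 4)"
    using m assms by (intro mult_left_mono) auto
  moreover have "t * (dist y m)\<^sup>2 \<le> t * ((dist y a)\<^sup>2 / 2 + (dist y b)\<^sup>2 / 2 - (dist a b)\<^sup>2 / 4)"
    using m assms by (intro mult_left_mono) auto
  ultimately show "(1 - t) * (dist m x)\<^sup>2 + t * (dist m y)\<^sup>2
      \<le> ((1 - t) * (dist a x)\<^sup>2 + t * (dist a y)\<^sup>2) / 2
        + ((1 - t) * (dist b x)\<^sup>2 + t * (dist b y)\<^sup>2) / 2 - (dist a b)\<^sup>2 / 4"
    by (simp add: dist_commute field_simps)
qed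

text \<open>The point at parameter \<open>t\<close> of the geodesic is found without dyadic subdivision, as the
  minimizer of \<open>(1 - t) * (dist w x)\<^sup>2 + t * (dist w y)\<^sup>2\<close>. The growth inequality evaluated
  at \<open>x\<close> and \<open>y\<close> bounds the minimum above by \<open>t * (1 - t) * (dist x y)\<^sup>2\<close>, the triangle
  inequality bounds it below by the same number, and the growth inequality then says that the
  minimizer satisfies the comparison inequality with the Euclidean plane.\<close>
lemma ex_npc_point:
  fixes x y :: "'a::hadamard_space"
  assumes t: "0 \<le> t" "t \<le> 1"
  shows "\<exists>p. dist x p = t * dist x y \<and> dist y p = (1 - t) * dist x y \<and>
    (\<forall>z. (dist z p)\<^sup>2 \<le> (1 - t) * (dist z x)\<^sup>2 + t * (dist z y)\<^sup>2 - t * (1 - t) * (dist x y)\<^sup>2)"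
proof -
  define \<phi> where "\<phi> w = (1 - t) * (dist w x)\<^sup>2 + t * (dist w y)\<^sup>2" for w
  have mc: "strongly_midpoint_convex \<phi>"
    using strongly_midpoint_convex_weighted_dist[OF t] unfolding \<phi>_def by blast
  have "continuous_on UNIV \<phi>" unfolding \<phi>_def by (intro continuous_intros)
  moreover have "0 \<le> \<phi> w" for w using t by (simp add: \<phi>_def)
  ultimately obtain p where "\<forall>w. \<phi> p \<le> \<phi> w"
    using strongly_midpoint_convex_ex_minimizer[OF mc] by blast
  then have growth: "\<phi> p + (dist w p)\<^sup>2 \<le> \<phi> w" for w
    using strongly_midpoint_convex_growth[OF mc] by blast
  define a b d where "a = dist x p" and "b = dist y p" and "d = dist x y"
  have \<phi>p: "\<phi> p = (1 - t) * a\<^sup>2 + t * b\<^sup>2" by (simp add: \<phi>_def a_def b_def dist_commute)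
  have gx: "\<phi> p + a\<^sup>2 \<le> t * d\<^sup>2" using growth[of x] by (simp add: \<phi>_def a_def d_def)
  have gy: "\<phi> p + b\<^sup>2 \<le> (1 - t) * d\<^sup>2"
    using growth[of y] by (simp add: \<phi>_def b_def d_def dist_commute)
  have up: "\<phi> p \<le> t * (1 - t) * d\<^sup>2"
    using mult_left_mono[OF gx, of "1 - t"] mult_left_mono[OF gy, of t] t
    by (simp add: \<phi>p algebra_simps)
  have tri: "d \<le> a + b" unfolding a_def b_def d_def by (rule dist_triangle2)
  have nn: "0 \<le> a" "0 \<le> b" "0 \<le> d" by (simp_all add: a_def b_def d_def)
  have "t * (1 - t) * d\<^sup>2 \<le> t * (1 - t) * (a + b)\<^sup>2"
    using tri nn t by (intro mult_left_mono power_mono) auto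
  moreover have id: "\<phi> p = t * (1 - t) * (a + b)\<^sup>2 + ((1 - t) * a - t * b)\<^sup>2"
    unfolding \<phi>p by (simp add: power2_eq_square algebra_simps)
  ultimately have low: "t * (1 - t) * d\<^sup>2 \<le> \<phi> p"
    by (smt (verit) zero_le_power2)
  have "a\<^sup>2 \<le> (t * d)\<^sup>2" using gx low by (simp add: power2_eq_square algebra_simps)
  then have a: "a \<le> t * d" by (rule power2_le_imp_le) (use t nn in simp)
  have "b\<^sup>2 \<le> ((1 - t) * d)\<^sup>2" using gy low by (simp add: power2_eq_square algebra_simps)
  then have b: "b \<le> (1 - t) * d" by (rule power2_le_imp_le) (use t nn in simp)
  have "a = t * d" "b = (1 - t) * d" using a b tri by (auto simp: algebra_simps)
  moreover have "(dist z p)\<^sup>2 \<le> \<phi> z - t * (1 - t) * d\<^sup>2" for z using growth[of z] low by simp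
  ultimately show ?thesis unfolding \<phi>_def a_def b_def d_def by blast
qed

text \<open>Uniqueness of geodesics: inserting \<open>\<gamma> t\<close> into the comparison inequality makes its right-hand
  side vanish.\<close>
lemma minimal_geodesic_npc_point:
  assumes t: "0 \<le> t" "t \<le> 1" and \<gamma>: "minimal_geodesic \<gamma> x y"
    and p: "\<And>z. (dist z p)\<^sup>2 \<le> (1 - t) * (dist z x)\<^sup>2 + t * (dist z y)\<^sup>2 - t * (1 - t) * (dist x y)\<^sup>2"
  shows "\<gamma> t = p"
proof -
  have ends: "\<gamma> 0 = x" "\<gamma> 1 = y"
    and speed: "\<forall>s\<in>{0..1}. \<forall>t\<in>{0..1}. dist (\<gamma> s) (\<gamma> t) = \<bar>t - s\<bar> * dist x y"
    using \<gamma> unfolding minimal_geodesic_def by blast+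
  have "dist (\<gamma> t) (\<gamma> 0) = \<bar>0 - t\<bar> * dist x y" "dist (\<gamma> t) (\<gamma> 1) = \<bar>1 - t\<bar> * dist x y"
    using speed t by (meson atLeastAtMost_iff order_refl zero_le_one)+
  then have "dist (\<gamma> t) x = t * dist x y" "dist (\<gamma> t) y = (1 - t) * dist x y"
    using t unfolding ends by simp_all
  with p[of "\<gamma> t"] have "(dist (\<gamma> t) p)\<^sup>2 \<le> 0" by (simp add: power2_eq_square algebra_simps)
  then show ?thesis by simp
qed

lemma ex_minimal_geodesic:
  fixes x y :: "'a::hadamard_space"
  shows "\<exists>\<gamma>. minimal_geodesic \<gamma> x y"
proof -
  have "\<forall>t. \<exists>p. 0 \<le> t \<longrightarrow> t \<le> 1 \<longrightarrow>
    dist x p = t * dist x y \<and> dist y p = (1 - t) * dist x y \<and>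
    (\<forall>z. (dist z p)\<^sup>2 \<le> (1 - t) * (dist z x)\<^sup>2 + t * (dist z y)\<^sup>2 - t * (1 - t) * (dist x y)\<^sup>2)"
    using ex_npc_point by blast
  then obtain g where g: "\<And>t. 0 \<le> t \<Longrightarrow> t \<le> 1 \<Longrightarrow> dist x (g t) = t * dist x y"
    "\<And>t. 0 \<le> t \<Longrightarrow> t \<le> 1 \<Longrightarrow> dist y (g t) = (1 - t) * dist x y"
    and npc: "\<And>t z. 0 \<le> t \<Longrightarrow> t \<le> 1 \<Longrightarrow>
      (dist z (g t))\<^sup>2 \<le> (1 - t) * (dist z x)\<^sup>2 + t * (dist z y)\<^sup>2 - t * (1 - t) * (dist x y)\<^sup>2"
    by metis
  have le: "dist (g s) (g t) \<le> \<bar>t - s\<bar> * dist x y" if "s \<in> {0..1}" "t \<in> {0..1}" for s t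
  proof -
    have "(dist (g s) (g t))\<^sup>2 \<le> (1 - t) * (s * dist x y)\<^sup>2 + t * ((1 - s) * dist x y)\<^sup>2
        - t * (1 - t) * (dist x y)\<^sup>2"
      using npc[of t "g s"] g[of s] that by (simp add: dist_commute)
    also have "\<dots> = ((t - s) * dist x y)\<^sup>2" by (simp add: power2_eq_square algebra_simps)
    finally show ?thesis by (metis abs_le_square_iff abs_mult abs_of_nonneg zero_le_dist)
  qed
  have ge: "\<bar>t - s\<bar> * dist x y \<le> dist (g s) (g t)" if "s \<in> {0..1}" "t \<in> {0..1}" for s t
  proof -
    have "\<bar>dist x (g t) - dist x (g s)\<bar> \<le> dist (g s) (g t)"
      by (smt (verit) dist_commute dist_triangle)
    also have "\<bar>dist x (g t) - dist x (g s)\<bar> = \<bar>t - s\<bar> * dist x y"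
      using g that by (simp add: left_diff_distrib[symmetric] abs_mult)
    finally show ?thesis .
  qed
  have "minimal_geodesic g x y"
    unfolding minimal_geodesic_def
    using g(1)[of 0] g(2)[of 1] le ge by (auto intro: antisym)
  then show ?thesis by blast
qed

lemma
  fixes x y :: "'a::hadamard_space"
  assumes t: "0 \<le> t" "t \<le> 1"
  shows dist_geodesic_point_left: "dist x (geodesic_point x t y) = t * dist x y"
    and dist_geodesic_point_right: "dist y (geodesic_point x t y) = (1 - t) * dist x y"
    and geodesic_point_npc: "(dist z (geodesic_point x t y))\<^sup>2
      \<le> (1 - t) * (dist z x)\<^sup>2 + t * (dist z y)\<^sup>2 - t * (1 - t) * (dist x y)\<^sup>2"
proof -
  obtain p where p: "dist x p = t * dist x y" "dist y p = (1 - t) * dist x y"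
    "\<And>z. (dist z p)\<^sup>2 \<le> (1 - t) * (dist z x)\<^sup>2 + t * (dist z y)\<^sup>2 - t * (1 - t) * (dist x y)\<^sup>2"
    using ex_npc_point[OF t] by metis
  obtain \<gamma> where \<gamma>: "minimal_geodesic \<gamma> x y" using ex_minimal_geodesic by blast
  have "geodesic_point x t y = p"
    unfolding geodesic_point_def
  proof (rule the_equality)
    show "\<exists>\<gamma>. minimal_geodesic \<gamma> x y \<and> \<gamma> t = p"
      using \<gamma> minimal_geodesic_npc_point[OF t \<gamma> p(3)] by blast
    show "w = p" if "\<exists>\<gamma>. minimal_geodesic \<gamma> x y \<and> \<gamma> t = w" for w
      using that minimal_geodesic_npc_point[OF t _ p(3)] by blast
  qed
  with p show "dist x (geodesic_point x t y) = t * dist x y"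
    "dist y (geodesic_point x t y) = (1 - t) * dist x y"
    "(dist z (geodesic_point x t y))\<^sup>2
      \<le> (1 - t) * (dist z x)\<^sup>2 + t * (dist z y)\<^sup>2 - t * (1 - t) * (dist x y)\<^sup>2"
    by auto
qed


lemma geodesic_point_in_ball:
  fixes x y z :: "'a::hadamard_space"
  assumes t: "0 \<le> t" "t \<le> 1" and "dist x z \<le> r" "dist y z \<le> r"
  shows "dist (geodesic_point x t y) z \<le> r"
proof -
  have "0 \<le> r" using assms(3) zero_le_dist order_trans by blast
  have "(dist z (geodesic_point x t y))\<^sup>2 \<le> (1 - t) * (dist z x)\<^sup>2 + t * (dist z y)\<^sup>2"
    using geodesic_point_npc[OF t, of z x y] t by (smt (verit) mult_nonneg_nonneg zero_le_power2)
  also have "\<dots> \<le> (1 - t) * r\<^sup>2 + t * r\<^sup>2"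
    using assms by (intro add_mono mult_left_mono power_mono) (auto simp: dist_commute)
  also have "\<dots> = r\<^sup>2" by (simp add: algebra_simps)
  finally have "dist z (geodesic_point x t y) \<le> r"
    using \<open>0 \<le> r\<close> by (rule power2_le_imp_le)
  then show ?thesis by (simp add: dist_commute)
qed

text \<open>The comparison inequality, applied to the point \<open>geodesic_point x' t y'\<close>, bounds its squared
  distance from \<open>geodesic_point x t y\<close> by an explicit continuous function of \<open>(x', y')\<close> that is zero
  at \<open>(x, y)\<close>. Joint continuity is needed for the measurability of inductive means.\<close>
lemma continuous_on_geodesic_point:
  assumes t: "0 \<le> t" "t \<le> 1"
  shows "continuous_on UNIV (\<lambda>(x, y). geodesic_point x t (y :: 'a::hadamard_space))"
  unfolding continuous_on_eq_continuous_at[OF open_UNIV]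
proof (intro ballI)
  fix w :: "'a \<times> 'a"
  obtain x y where w: "w = (x, y)" by (cases w)
  define g where "g v = geodesic_point (fst v) t (snd v)" for v :: "'a \<times> 'a"
  define B where "B v = (1 - t) * (t * dist (fst v) (snd v) + dist (fst v) x)\<^sup>2
     + t * ((1 - t) * dist (fst v) (snd v) + dist (snd v) y)\<^sup>2 - t * (1 - t) * (dist x y)\<^sup>2"
    for v :: "'a \<times> 'a"
  have le: "(dist (g v) (g w))\<^sup>2 \<le> B v" for v
  proof -
    have "dist (g v) x \<le> t * dist (fst v) (snd v) + dist (fst v) x"
      using dist_geodesic_point_left[OF t, of "fst v" "snd v"]
        dist_triangle[of "g v" x "fst v"] by (simp add: g_def dist_commute)
    moreover have "dist (g v) y \<le> (1 - t) * dist (fst v) (snd v) + dist (snd v) y"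
      using dist_geodesic_point_right[OF t, of "snd v" "fst v"]
        dist_triangle[of "g v" y "snd v"] by (simp add: g_def dist_commute)
    ultimately have "(1 - t) * (dist (g v) x)\<^sup>2 + t * (dist (g v) y)\<^sup>2 - t * (1 - t) * (dist x y)\<^sup>2 \<le> B v"
      using t unfolding B_def by (intro diff_right_mono add_mono mult_left_mono power_mono) auto
    then show ?thesis
      using geodesic_point_npc[OF t, of "g v" x y] by (simp add: w g_def)
  qed
  have "(B \<longlongrightarrow> B w) (at w)"
    unfolding B_def by (intro tendsto_intros)
  moreover have "B w = 0" by (simp add: B_def w power2_eq_square algebra_simps)
  ultimately have B0: "(B \<longlongrightarrow> 0) (at w)" by simp
  have "((\<lambda>v. (dist (g v) (g w))\<^sup>2) \<longlongrightarrow> 0) (at w)"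
    by (rule tendsto_sandwich[OF _ _ tendsto_const B0]) (simp_all add: le)
  then have "((\<lambda>v. sqrt ((dist (g v) (g w))\<^sup>2)) \<longlongrightarrow> sqrt 0) (at w)" by (rule tendsto_real_sqrt)
  then have "(g \<longlongrightarrow> g w) (at w)" by (subst tendsto_dist_iff) simp
  then show "isCont (\<lambda>(x, y). geodesic_point x t y) w"
    unfolding isCont_def g_def by (simp add: case_prod_beta')
qed



section \<open>The variance inequality\<close>

lemma square_integrable_dist:
  assumes "prob_space M" "square_integrable M X"
  shows "integrable M (\<lambda>\<omega>. (dist (X \<omega>) w)\<^sup>2)"
proof -
  interpret prob_space M by fact
  obtain z where z: "integrable M (\<lambda>\<omega>. (dist (X \<omega>) z)\<^sup>2)" and X: "X \<in> borel_measurable M"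
    using assms(2) unfolding square_integrable_def by blast
  have meas: "(\<lambda>\<omega>. (dist (X \<omega>) w)\<^sup>2) \<in> borel_measurable M"
    by (rule borel_measurable_continuous_on[OF _ X]) (intro continuous_intros)
  show ?thesis
  proof (rule Bochner_Integration.integrable_bound[OF _ meas])
    show "integrable M (\<lambda>\<omega>. 2 * (dist (X \<omega>) z)\<^sup>2 + 2 * (dist z w)\<^sup>2)"
      using z by simp
    have "(dist (X \<omega>) w)\<^sup>2 \<le> 2 * (dist (X \<omega>) z)\<^sup>2 + 2 * (dist z w)\<^sup>2" for \<omega>
    proof -
      have "(dist (X \<omega>) w)\<^sup>2 \<le> (dist (X \<omega>) z + dist z w)\<^sup>2"
        by (intro power_mono dist_triangle) simp
      also have "\<dots> \<le> 2 * (dist (X \<omega>) z)\<^sup>2 + 2 * (dist z w)\<^sup>2"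
        using zero_le_power2[of "dist (X \<omega>) z - dist z w"]
        by (simp add: power2_eq_square algebra_simps)
      finally show ?thesis .
    qed
    then show "AE \<omega> in M. norm ((dist (X \<omega>) w)\<^sup>2) \<le> norm (2 * (dist (X \<omega>) z)\<^sup>2 + 2 * (dist z w)\<^sup>2)"
      by simp
  qed
qed

lemma strongly_midpoint_convex_expected_square_dist:
  fixes X :: "'b \<Rightarrow> 'a::hadamard_space"
  assumes "prob_space M" "square_integrable M X"
  shows "strongly_midpoint_convex (\<lambda>w. \<integral>\<omega>. (dist (X \<omega>) w)\<^sup>2 \<partial>M)"
  unfolding strongly_midpoint_convex_def
proof (intro allI impI)
  interpret prob_space M by fact
  note [simp] = square_integrable_dist[OF assms]
  fix a b m :: 'a
  assume m: "\<forall>z. (dist z m)\<^sup>2 \<le> (dist z a)\<^sup>2 / 2 + (dist z b)\<^sup>2 / 2 - (dist a b)\<^sup>2 / 4"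
  have "(\<integral>\<omega>. (dist (X \<omega>) m)\<^sup>2 \<partial>M)
      \<le> (\<integral>\<omega>. (dist (X \<omega>) a)\<^sup>2 / 2 + (dist (X \<omega>) b)\<^sup>2 / 2 - (dist a b)\<^sup>2 / 4 \<partial>M)"
  proof (rule integral_mono)
    show "(dist (X \<omega>) m)\<^sup>2 \<le> (dist (X \<omega>) a)\<^sup>2 / 2 + (dist (X \<omega>) b)\<^sup>2 / 2 - (dist a b)\<^sup>2 / 4" for \<omega>
      by (rule m[rule_format])
  qed simp_all
  then show "(\<integral>\<omega>. (dist (X \<omega>) m)\<^sup>2 \<partial>M) \<le> (\<integral>\<omega>. (dist (X \<omega>) a)\<^sup>2 \<partial>M) / 2
      + (\<integral>\<omega>. (dist (X \<omega>) b)\<^sup>2 \<partial>M) / 2 - (dist a b)\<^sup>2 / 4"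
    by (simp add: prob_space)
qed

lemma continuous_expected_square_dist:
  fixes X :: "'b \<Rightarrow> 'a::hadamard_space"
  assumes "prob_space M" "square_integrable M X"
  shows "continuous_on UNIV (\<lambda>w. \<integral>\<omega>. (dist (X \<omega>) w)\<^sup>2 \<partial>M)"
proof (rule continuous_on_sequentiallyI)
  interpret prob_space M by fact
  note int = square_integrable_dist[OF assms]
  fix u :: "nat \<Rightarrow> 'a" and a assume u: "u \<longlonglongrightarrow> a"
  have "Bseq (\<lambda>n. dist (u n) a)"
    by (rule convergent_imp_Bseq, rule convergentI, rule tendsto_dist[OF u tendsto_const])
  then obtain B where B: "\<And>n. dist (u n) a \<le> B" by (auto simp: Bseq_def)
  show "(\<lambda>n. \<integral>\<omega>. (dist (X \<omega>) (u n))\<^sup>2 \<partial>M) \<longlonglongrightarrow> (\<integral>\<omega>. (dist (X \<omega>) a)\<^sup>2 \<partial>M)"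
  proof (rule integral_dominated_convergence)
    show "integrable M (\<lambda>\<omega>. 2 * (dist (X \<omega>) a)\<^sup>2 + 2 * B\<^sup>2)" using int by simp
    show "AE \<omega> in M. (\<lambda>n. (dist (X \<omega>) (u n))\<^sup>2) \<longlonglongrightarrow> (dist (X \<omega>) a)\<^sup>2"
      by (intro AE_I2 tendsto_intros u)
    fix n
    have "(dist (X \<omega>) (u n))\<^sup>2 \<le> 2 * (dist (X \<omega>) a)\<^sup>2 + 2 * B\<^sup>2" for \<omega>
    proof -
      have "(dist (X \<omega>) (u n))\<^sup>2 \<le> (dist (X \<omega>) a + B)\<^sup>2"
        using B[of n] dist_triangle2[of "X \<omega>" "u n" a] by (intro power_mono) auto
      also have "\<dots> \<le> 2 * (dist (X \<omega>) a)\<^sup>2 + 2 * B\<^sup>2"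
        using zero_le_power2[of "dist (X \<omega>) a - B"]
        by (simp add: power2_eq_square algebra_simps)
      finally show ?thesis .
    qed
    then show "AE \<omega> in M. norm ((dist (X \<omega>) (u n))\<^sup>2) \<le> 2 * (dist (X \<omega>) a)\<^sup>2 + 2 * B\<^sup>2" by simp
  qed (use int in \<open>auto dest: borel_measurable_integrable\<close>)
qed

text \<open>The expectation minimizes \<open>w \<mapsto> \<integral>\<omega>. (dist (X \<omega>) w)\<^sup>2 \<partial>M\<close>, which is
  strongly convex along midpoints, so this is the growth inequality. In a Euclidean space it is the
  identity that decomposes the second moment about \<open>w\<close> into the variance and the square of the
  bias.\<close>
lemma variance_inequality:
  fixes X :: "'b \<Rightarrow> 'a::hadamard_space"
  assumes "prob_space M" "square_integrable M X"
  shows "(\<integral>\<omega>. (dist (X \<omega>) (hadamard_expectation M X))\<^sup>2 \<partial>M) + (dist w (hadamard_expectation M X))\<^sup>2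
    \<le> (\<integral>\<omega>. (dist (X \<omega>) w)\<^sup>2 \<partial>M)"
proof -
  define F where "F w = (\<integral>\<omega>. (dist (X \<omega>) w)\<^sup>2 \<partial>M)" for w
  have mc: "strongly_midpoint_convex F"
    using strongly_midpoint_convex_expected_square_dist[OF assms] unfolding F_def .
  have "continuous_on UNIV F"
    using continuous_expected_square_dist[OF assms] unfolding F_def .
  then obtain m where m: "\<forall>w. F m \<le> F w"
    using strongly_midpoint_convex_ex_minimizer[OF mc] by (auto simp: F_def)
  have growth: "F m + (dist w m)\<^sup>2 \<le> F w" for w
    using strongly_midpoint_convex_growth[OF mc] m by blast
  have "hadamard_expectation M X = m"
    unfolding hadamard_expectation_def
  proof (rule the_equality)
    show "\<forall>w. (\<integral>\<omega>. (dist (X \<omega>) m)\<^sup>2 \<partial>M) \<le> (\<integral>\<omega>. (dist (X \<omega>) w)\<^sup>2 \<partial>M)"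
      using m by (simp add: F_def)
    fix m' assume "\<forall>w. (\<integral>\<omega>. (dist (X \<omega>) m')\<^sup>2 \<partial>M) \<le> (\<integral>\<omega>. (dist (X \<omega>) w)\<^sup>2 \<partial>M)"
    then have "F m' \<le> F m" by (simp add: F_def)
    with growth[of m'] have "(dist m' m)\<^sup>2 \<le> 0" by linarith
    then show "m' = m" by simp
  qed
  with growth[of w] show ?thesis by (simp add: F_def)
qed

section \<open>Measurability of inductive means\<close>

text \<open>In a nonseparable metric space the Borel \<open>\<sigma>\<close>-algebra of a product can be larger than the
  product of the Borel \<open>\<sigma>\<close>-algebras, so a pair of Borel functions need not be Borel. Pairs of
  functions with separable range are. The range condition is imposed at every argument, also
  outside of \<open>space M\<close>, so that inclusions and equations between such functions hold without side
  conditions.\<close>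
definition separable_measurable :: "'b measure \<Rightarrow> ('b \<Rightarrow> 'a::metric_space) \<Rightarrow> bool" where
  "separable_measurable M f \<longleftrightarrow>
     f \<in> borel_measurable M \<and> (\<exists>D. countable D \<and> range f \<subseteq> closure D)"

text \<open>On the product of the ranges every open set is a countable union of products of balls with
  centres in the countable dense sets and radii \<open>1 / Suc n\<close>.\<close>
lemma separable_measurable_Pair:
  fixes f :: "'b \<Rightarrow> 'a::metric_space" and g :: "'b \<Rightarrow> 'c::metric_space"
  assumes "separable_measurable M f" "separable_measurable M g"
  shows "separable_measurable M (\<lambda>\<omega>. (f \<omega>, g \<omega>))"
proof -
  obtain D E where D: "countable D" "range f \<subseteq> closure D" and E: "countable E" "range g \<subseteq> closure E"
    and f[measurable]: "f \<in> borel_measurable M" and g[measurable]: "g \<in> borel_measurable M"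
    using assms unfolding separable_measurable_def by metis
  have "(\<lambda>\<omega>. (f \<omega>, g \<omega>)) \<in> borel_measurable M"
  proof (rule borel_measurableI)
    fix U :: "('a \<times> 'c) set" assume U: "open U"
    define J where "J = {(a, b, n). a \<in> D \<and> b \<in> E
      \<and> ball a (1 / real (Suc n)) \<times> ball b (1 / real (Suc n)) \<subseteq> U}"
    have "J \<subseteq> D \<times> E \<times> UNIV" by (auto simp: J_def)
    then have J: "countable J"
      by (rule countable_subset) (use D(1) E(1) in auto)
    have "(\<lambda>\<omega>. (f \<omega>, g \<omega>)) -` U \<inter> space M = (\<Union>(a, b, n)\<in>J.
      (f -` ball a (1 / real (Suc n)) \<inter> space M) \<inter> (g -` ball b (1 / real (Suc n)) \<inter> space M))"
      (is "?L = ?R")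
    proof
      show "?R \<subseteq> ?L" by (auto simp: J_def)
      show "?L \<subseteq> ?R"
      proof
        fix \<omega> assume \<omega>: "\<omega> \<in> ?L"
        then obtain A B where AB: "open A" "open B" "f \<omega> \<in> A" "g \<omega> \<in> B" "A \<times> B \<subseteq> U"
          using U unfolding open_prod_def by fastforce
        obtain e1 where e1: "e1 > 0" "ball (f \<omega>) e1 \<subseteq> A"
          using AB open_contains_ball by blast
        obtain e2 where e2: "e2 > 0" "ball (g \<omega>) e2 \<subseteq> B"
          using AB open_contains_ball by blast
        obtain n where n: "1 / real (Suc n) < min e1 e2 / 2"
          using nat_approx_posE[of "min e1 e2 / 2"] e1 e2 by auto
        have pos: "0 < 1 / real (Suc n)" by simp
        obtain a where a: "a \<in> D" "dist a (f \<omega>) < 1 / real (Suc n)"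
          using D(2) closure_approachable[of "f \<omega>" D] pos by blast
        obtain b where b: "b \<in> E" "dist b (g \<omega>) < 1 / real (Suc n)"
          using E(2) closure_approachable[of "g \<omega>" E] pos by blast
        have "ball a (1 / real (Suc n)) \<subseteq> ball (f \<omega>) e1"
        proof
          fix v assume "v \<in> ball a (1 / real (Suc n))"
          then show "v \<in> ball (f \<omega>) e1"
            using a n dist_triangle[of "f \<omega>" v a] dist_commute[of a "f \<omega>"] by simp
        qed
        moreover have "ball b (1 / real (Suc n)) \<subseteq> ball (g \<omega>) e2"
        proof
          fix v assume "v \<in> ball b (1 / real (Suc n))"
          then show "v \<in> ball (g \<omega>) e2"
            using b n dist_triangle[of "g \<omega>" v b] dist_commute[of b "g \<omega>"] by simp
        qed
        ultimately have "ball a (1 / real (Suc n)) \<times> ball b (1 / real (Suc n)) \<subseteq> U"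
          using e1 e2 AB(5) by blast
        then have "(a, b, n) \<in> J" using a b by (simp add: J_def)
        moreover have "f \<omega> \<in> ball a (1 / real (Suc n))" "g \<omega> \<in> ball b (1 / real (Suc n))"
          using a b by auto
        ultimately show "\<omega> \<in> ?R" using \<omega> by blast
      qed
    qed
    also have "\<dots> \<in> sets M"
      using J by (intro sets.countable_UN') (auto intro!: measurable_sets)
    finally show "(\<lambda>\<omega>. (f \<omega>, g \<omega>)) -` U \<inter> space M \<in> sets M" .
  qed
  moreover have "range (\<lambda>\<omega>. (f \<omega>, g \<omega>)) \<subseteq> closure (D \<times> E)"
    using D E by (auto simp: closure_Times)
  moreover have "countable (D \<times> E)" using D E by simp
  ultimately show ?thesis
    unfolding separable_measurable_def by (intro conjI exI[of _ "D \<times> E"])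
qed

lemma separable_measurable_continuous:
  fixes g :: "'a::metric_space \<Rightarrow> 'c::metric_space"
  assumes g: "continuous_on UNIV g" and f: "separable_measurable M f"
  shows "separable_measurable M (\<lambda>\<omega>. g (f \<omega>))"
proof -
  obtain D where D: "countable D" "range f \<subseteq> closure D" and m: "f \<in> borel_measurable M"
    using f unfolding separable_measurable_def by metis
  have "g ` closure D \<subseteq> closure (g ` D)"
    by (rule image_closure_subset) (auto intro: continuous_on_subset[OF g] closure_subset[THEN subsetD])
  then have "range (\<lambda>\<omega>. g (f \<omega>)) \<subseteq> closure (g ` D)" using D(2) by blast
  moreover have "(\<lambda>\<omega>. g (f \<omega>)) \<in> borel_measurable M"
    by (rule borel_measurable_continuous_on[OF g m])
  ultimately show ?thesis using D(1) unfolding separable_measurable_def by blast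
qed

lemma separable_measurable_comp:
  assumes "separable_measurable N f" "g \<in> measurable M N"
  shows "separable_measurable M (\<lambda>\<omega>. f (g \<omega>))"
proof -
  obtain D where D: "countable D" "range f \<subseteq> closure D" and f: "f \<in> borel_measurable N"
    using assms(1) unfolding separable_measurable_def by metis
  have "(\<lambda>\<omega>. f (g \<omega>)) \<in> borel_measurable M" by (rule measurable_compose[OF assms(2) f])
  moreover have "range (\<lambda>\<omega>. f (g \<omega>)) \<subseteq> closure D" using D(2) by auto
  ultimately show ?thesis
    using D(1) unfolding separable_measurable_def by (intro conjI exI[of _ D])
qed

lemma separable_measurable_dist:
  assumes "separable_measurable M f" "separable_measurable M g"
  shows "(\<lambda>\<omega>. dist (f \<omega>) (g \<omega>)) \<in> borel_measurable M"
proof -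
  have "separable_measurable M (\<lambda>\<omega>. (\<lambda>p. dist (fst p) (snd p)) (f \<omega>, g \<omega>))"
    by (rule separable_measurable_continuous[OF _ separable_measurable_Pair[OF assms]])
      (intro continuous_intros)
  then show ?thesis by (simp add: separable_measurable_def)
qed

lemma separable_measurable_inductive_mean:
  fixes f :: "nat \<Rightarrow> 'b \<Rightarrow> 'a::hadamard_space"
  assumes "\<And>k. 1 \<le> k \<Longrightarrow> k \<le> n \<Longrightarrow> separable_measurable M (f k)" and "1 \<le> n"
  shows "separable_measurable M (\<lambda>\<omega>. inductive_mean (\<lambda>k. f k \<omega>) n)"
  using assms(2,1)
proof (induction n rule: dec_induct)
  case base then show ?case by simp
next
  case (step n)
  obtain m where n: "n = Suc m" using step(1) by (cases n) auto
  define t where "t = 1 / real (Suc n)"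
  have S: "separable_measurable M (\<lambda>\<omega>. inductive_mean (\<lambda>k. f k \<omega>) n)"
    by (rule step.IH, rule step.prems) auto
  have X: "separable_measurable M (f (Suc n))" by (rule step.prems) auto
  have cont: "continuous_on UNIV (\<lambda>(x, y). geodesic_point x t (y :: 'a))"
    by (rule continuous_on_geodesic_point) (simp_all add: t_def)
  have "separable_measurable M (\<lambda>\<omega>. (\<lambda>(x, y). geodesic_point x t y)
      (inductive_mean (\<lambda>k. f k \<omega>) n, f (Suc n) \<omega>))"
    by (rule separable_measurable_continuous[OF cont separable_measurable_Pair[OF S X]])
  then show ?case by (simp add: n t_def)
qed

lemma inductive_mean_cong:
  assumes "\<And>k. 1 \<le> k \<Longrightarrow> k \<le> n \<Longrightarrow> x k = y k" and "1 \<le> n"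
  shows "inductive_mean x n = inductive_mean y n"
  using assms(2,1)
proof (induction n rule: dec_induct)
  case (step n)
  then obtain m where "n = Suc m" by (cases n) auto
  with step show ?case by simp
qed simp

lemma measurable_retraction_closed:
  fixes A :: "'a::metric_space set"
  assumes "closed A"
  shows "(\<lambda>x. if x \<in> A then x else a) \<in> borel_measurable borel"
  using assms by (intro measurable_If_set) auto



section \<open>One step of the inductive mean\<close>

text \<open>Fubini's theorem for the joint law of independent variables, pulled back to the sample space. It
  replaces conditioning on the past of the sequence.\<close>
lemma (in prob_space) integral_indep_pair:
  fixes g :: "'c \<times> 'c \<Rightarrow> real"
  assumes indep: "indep_var N S L X" and g: "g \<in> borel_measurable (N \<Otimes>\<^sub>M L)"
    and int: "integrable M (\<lambda>\<omega>. g (S \<omega>, X \<omega>))"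
  shows "integrable M (\<lambda>\<omega>. \<integral>\<omega>'. g (S \<omega>, X \<omega>') \<partial>M)"
    and "(\<integral>\<omega>. g (S \<omega>, X \<omega>) \<partial>M) = (\<integral>\<omega>. (\<integral>\<omega>'. g (S \<omega>, X \<omega>') \<partial>M) \<partial>M)"
proof -
  have S[measurable]: "S \<in> measurable M N" and X[measurable]: "X \<in> measurable M L"
    using indep_var_rv1[OF indep] indep_var_rv2[OF indep] by auto
  interpret S: prob_space "distr M N S" by (rule prob_space_distr) simp
  interpret X: prob_space "distr M L X" by (rule prob_space_distr) simp
  interpret P: pair_prob_space "distr M N S" "distr M L X" ..
  note law = indep_var_distribution_eq[THEN iffD1, OF indep, THEN conjunct2, THEN conjunct2]
  have SX: "(\<lambda>\<omega>. (S \<omega>, X \<omega>)) \<in> measurable M (N \<Otimes>\<^sub>M L)" by simp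
  have "integrable (distr M (N \<Otimes>\<^sub>M L) (\<lambda>\<omega>. (S \<omega>, X \<omega>))) g"
    using int by (simp add: integrable_distr_eq[OF SX g])
  then have int': "integrable (distr M N S \<Otimes>\<^sub>M distr M L X) g" by (simp add: law)
  have inner: "(\<integral>x. g (s, x) \<partial>distr M L X) = (\<integral>\<omega>'. g (s, X \<omega>') \<partial>M)" if "s \<in> space N" for s
    by (rule integral_distr[OF X]) (rule measurable_compose[OF measurable_Pair1'[OF that] g])
  have outer: "integrable (distr M N S) (\<lambda>s. \<integral>x. g (s, x) \<partial>distr M L X)"
    by (rule P.integrable_fst'[OF int'])
  then have om: "(\<lambda>s. \<integral>x. g (s, x) \<partial>distr M L X) \<in> borel_measurable N"
    using borel_measurable_integrable by force
  have "integrable M (\<lambda>\<omega>. \<integral>x. g (S \<omega>, x) \<partial>distr M L X)"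
    using outer integrable_distr_eq[OF S om] by simp
  then show "integrable M (\<lambda>\<omega>. \<integral>\<omega>'. g (S \<omega>, X \<omega>') \<partial>M)"
    by (rule Bochner_Integration.integrable_cong[THEN iffD1, rotated -1])
      (auto simp: inner measurable_space[OF S])
  have "(\<integral>\<omega>. g (S \<omega>, X \<omega>) \<partial>M) = (\<integral>p. g p \<partial>distr M (N \<Otimes>\<^sub>M L) (\<lambda>\<omega>. (S \<omega>, X \<omega>)))"
    by (rule integral_distr[OF SX g, symmetric])
  also have "\<dots> = (\<integral>s. (\<integral>x. g (s, x) \<partial>distr M L X) \<partial>distr M N S)"
    by (simp add: law[symmetric] P.integral_fst'[OF int'])
  also have "\<dots> = (\<integral>\<omega>. (\<integral>x. g (S \<omega>, x) \<partial>distr M L X) \<partial>M)"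
    by (rule integral_distr[OF S om])
  also have "\<dots> = (\<integral>\<omega>. (\<integral>\<omega>'. g (S \<omega>, X \<omega>') \<partial>M) \<partial>M)"
    by (rule Bochner_Integration.integral_cong) (auto simp: inner measurable_space[OF S])
  finally show "(\<integral>\<omega>. g (S \<omega>, X \<omega>) \<partial>M) = (\<integral>\<omega>. (\<integral>\<omega>'. g (S \<omega>, X \<omega>') \<partial>M) \<partial>M)" .
qed

lemma separable_measurable_retraction:
  fixes D :: "'a::metric_space set"
  assumes "countable D" "a \<in> closure D"
  shows "separable_measurable borel (\<lambda>x. if x \<in> closure D then x else a)"
  unfolding separable_measurable_def
  using assms measurable_retraction_closed[of "closure D" a] by auto

lemma square_integrable_pair_dist:
  assumes "prob_space M" "square_integrable M S" "square_integrable M X"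
    and "separable_measurable M S" "separable_measurable M X"
  shows "integrable M (\<lambda>\<omega>. (dist (S \<omega>) (X \<omega>))\<^sup>2)"
proof (rule Bochner_Integration.integrable_bound)
  fix w :: 'b
  show "integrable M (\<lambda>\<omega>. 2 * (dist (S \<omega>) w)\<^sup>2 + 2 * (dist (X \<omega>) w)\<^sup>2)"
    using square_integrable_dist[OF assms(1,2), of w] square_integrable_dist[OF assms(1,3), of w]
    by simp
  have "(dist (S \<omega>) (X \<omega>))\<^sup>2 \<le> 2 * (dist (S \<omega>) w)\<^sup>2 + 2 * (dist (X \<omega>) w)\<^sup>2" for \<omega>
  proof -
    have "(dist (S \<omega>) (X \<omega>))\<^sup>2 \<le> (dist (S \<omega>) w + dist (X \<omega>) w)\<^sup>2"
      by (intro power_mono dist_triangle2) simp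
    also have "\<dots> \<le> 2 * (dist (S \<omega>) w)\<^sup>2 + 2 * (dist (X \<omega>) w)\<^sup>2"
      using zero_le_power2[of "dist (S \<omega>) w - dist (X \<omega>) w"]
      by (simp add: power2_eq_square algebra_simps)
    finally show ?thesis .
  qed
  then show "AE \<omega> in M. norm ((dist (S \<omega>) (X \<omega>))\<^sup>2)
      \<le> norm (2 * (dist (S \<omega>) w)\<^sup>2 + 2 * (dist (X \<omega>) w)\<^sup>2)" by simp
  show "(\<lambda>\<omega>. (dist (S \<omega>) (X \<omega>))\<^sup>2) \<in> borel_measurable M"
    using separable_measurable_dist[OF assms(4,5)] by simp
qed

text \<open>For a fixed value of \<open>S\<close> this is the variance inequality for \<open>X\<close>; independence allows to
  integrate it over the values of \<open>S\<close>.\<close>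
lemma variance_inequality_indep:
  fixes S X :: "'b \<Rightarrow> 'a::hadamard_space"
  assumes M: "prob_space M" and indep: "prob_space.indep_var M borel S borel X"
    and S: "separable_measurable M S" "square_integrable M S"
    and X: "separable_measurable M X" "square_integrable M X"
  shows "(\<integral>\<omega>. (dist (X \<omega>) (hadamard_expectation M X))\<^sup>2 \<partial>M)
      + (\<integral>\<omega>. (dist (S \<omega>) (hadamard_expectation M X))\<^sup>2 \<partial>M) \<le> (\<integral>\<omega>. (dist (S \<omega>) (X \<omega>))\<^sup>2 \<partial>M)"
proof -
  interpret prob_space M by (rule M)
  obtain D E where D: "countable D" "range S \<subseteq> closure D" and E: "countable E" "range X \<subseteq> closure E"
    using S(1) X(1) unfolding separable_measurable_def by metis
  define W where "W = closure (D \<union> E)"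
  have SW: "S \<omega> \<in> W" and XW: "X \<omega> \<in> W" for \<omega> using D E by (auto simp: W_def closure_Un)
  define \<rho> where "\<rho> v = (if v \<in> W then v else S undefined)" for v
  have \<rho>: "separable_measurable borel \<rho>"
    unfolding \<rho>_def W_def
    by (rule separable_measurable_retraction) (use D E SW[of undefined] in \<open>auto simp: W_def\<close>)
  define g where "g p = (dist (\<rho> (fst p)) (\<rho> (snd p)))\<^sup>2" for p
  have "separable_measurable (borel \<Otimes>\<^sub>M borel) (\<lambda>p :: 'a \<times> 'a. \<rho> (fst p))"
    "separable_measurable (borel \<Otimes>\<^sub>M borel) (\<lambda>p :: 'a \<times> 'a. \<rho> (snd p))"
    by (rule separable_measurable_comp[OF \<rho>], simp)+
  then have g: "g \<in> borel_measurable (borel \<Otimes>\<^sub>M borel)"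
    unfolding g_def by (intro borel_measurable_power separable_measurable_dist)
  have gSX: "g (S \<omega>, X \<omega>') = (dist (X \<omega>') (S \<omega>))\<^sup>2" for \<omega> \<omega>'
    using SW XW by (simp add: g_def \<rho>_def dist_commute)
  define m where "m = hadamard_expectation M X"
  define V where "V = (\<integral>\<omega>. (dist (X \<omega>) m)\<^sup>2 \<partial>M)"
  have int: "integrable M (\<lambda>\<omega>. g (S \<omega>, X \<omega>))"
    using square_integrable_pair_dist[OF M X(2) S(2) X(1) S(1)] by (simp add: gSX)
  have "V + (\<integral>\<omega>. (dist (S \<omega>) m)\<^sup>2 \<partial>M) = (\<integral>\<omega>. V + (dist (S \<omega>) m)\<^sup>2 \<partial>M)"
    using square_integrable_dist[OF M S(2)] by (simp add: prob_space)
  also have "\<dots> \<le> (\<integral>\<omega>. (\<integral>\<omega>'. g (S \<omega>, X \<omega>') \<partial>M) \<partial>M)"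
  proof (rule integral_mono)
    show "integrable M (\<lambda>\<omega>. V + (dist (S \<omega>) m)\<^sup>2)"
      using square_integrable_dist[OF M S(2)] by simp
    show "integrable M (\<lambda>\<omega>. \<integral>\<omega>'. g (S \<omega>, X \<omega>') \<partial>M)"
      by (rule integral_indep_pair(1)[OF indep g int])
    show "V + (dist (S \<omega>) m)\<^sup>2 \<le> (\<integral>\<omega>'. g (S \<omega>, X \<omega>') \<partial>M)" for \<omega>
      using variance_inequality[OF M X(2), of "S \<omega>"] by (simp add: gSX V_def m_def)
  qed
  also have "\<dots> = (\<integral>\<omega>. g (S \<omega>, X \<omega>) \<partial>M)"
    by (rule integral_indep_pair(2)[OF indep g int, symmetric])
  finally show ?thesis by (simp add: gSX V_def m_def dist_commute)
qed

lemma square_integrable_bounded: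
  assumes "prob_space M" "X \<in> borel_measurable M" "\<And>\<omega>. dist (X \<omega>) w \<le> R"
  shows "square_integrable M X"
proof -
  interpret prob_space M by fact
  have "(\<lambda>\<omega>. (dist (X \<omega>) w)\<^sup>2) \<in> borel_measurable M"
    by (rule borel_measurable_continuous_on[OF _ assms(2)]) (intro continuous_intros)
  then have "integrable M (\<lambda>\<omega>. (dist (X \<omega>) w)\<^sup>2)"
    by (rule integrable_const_bound[of _ "R\<^sup>2", rotated]) (use assms(3) in \<open>auto intro!: power_mono\<close>)
  with assms(2) show ?thesis unfolding square_integrable_def by blast
qed

text \<open>Write \<open>m\<close> for the expectation of \<open>X\<close> and \<open>\<delta>\<close> for its distance from \<open>\<mu>\<close>.
  The comparison inequality bounds the left-hand side by \<open>(1 - t) * a + t * b - t * (1 - t) * c\<close>,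
  where \<open>a\<close>, \<open>b\<close> and \<open>c\<close> are the second moments of the distances between \<open>S\<close> and
  \<open>\<mu>\<close>, \<open>X\<close> and \<open>\<mu>\<close>, and \<open>S\<close> and \<open>X\<close>. By independence \<open>c\<close> is at least the
  variance of \<open>X\<close> plus the second moment of the distance between \<open>S\<close> and \<open>m\<close>. If \<open>m = \<mu>\<close>,
  this leaves \<open>(1 - t)\<^sup>2 * a\<close> plus \<open>t\<^sup>2\<close> times the variance. In general, moving the
  reference point from \<open>m\<close> to \<open>\<mu>\<close> increases each squared distance by at most
  \<open>2 * \<delta> * R\<close>, because all distances from \<open>\<mu>\<close> are bounded by \<open>R\<close>.\<close>
lemma expected_square_dist_step:
  fixes S X :: "'b \<Rightarrow> 'a::hadamard_space"
  assumes M: "prob_space M" and indep: "prob_space.indep_var M borel S borel X"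
    and S: "separable_measurable M S" "\<And>\<omega>. dist (S \<omega>) \<mu> \<le> R"
    and X: "separable_measurable M X" "\<And>\<omega>. dist (X \<omega>) \<mu> \<le> R"
    and t: "0 \<le> t" "t \<le> 1"
  shows "(\<integral>\<omega>. (dist (geodesic_point (S \<omega>) t (X \<omega>)) \<mu>)\<^sup>2 \<partial>M)
    \<le> (1 - t)\<^sup>2 * (\<integral>\<omega>. (dist (S \<omega>) \<mu>)\<^sup>2 \<partial>M)
      + 4 * t * R * dist (hadamard_expectation M X) \<mu> + t\<^sup>2 * R\<^sup>2"
proof -
  interpret prob_space M by (rule M)
  define m where "m = hadamard_expectation M X"
  define \<delta> where "\<delta> = dist m \<mu>"
  have "0 \<le> R" using S(2) zero_le_dist order_trans by blast
  have sqS: "square_integrable M S" and sqX: "square_integrable M X"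
    using S X square_integrable_bounded[OF M] unfolding separable_measurable_def by blast+
  note intS [simp] = square_integrable_dist[OF M sqS] and intX [simp] = square_integrable_dist[OF M sqX]
  have intSX [simp]: "integrable M (\<lambda>\<omega>. (dist (S \<omega>) (X \<omega>))\<^sup>2)"
    by (rule square_integrable_pair_dist[OF M sqS sqX S(1) X(1)])
  define a where "a = (\<integral>\<omega>. (dist (S \<omega>) \<mu>)\<^sup>2 \<partial>M)"
  define b where "b = (\<integral>\<omega>. (dist (X \<omega>) \<mu>)\<^sup>2 \<partial>M)"
  define c where "c = (\<integral>\<omega>. (dist (S \<omega>) (X \<omega>))\<^sup>2 \<partial>M)"
  define e where "e = (\<integral>\<omega>. (dist (S \<omega>) m)\<^sup>2 \<partial>M)"
  define V where "V = (\<integral>\<omega>. (dist (X \<omega>) m)\<^sup>2 \<partial>M)"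
  have shift: "(dist v \<mu>)\<^sup>2 \<le> (dist v m)\<^sup>2 + 2 * \<delta> * R" if "dist v \<mu> \<le> R" for v
  proof -
    have tri: "dist v \<mu> \<le> dist v m + \<delta>" unfolding \<delta>_def by (rule dist_triangle)
    have "(dist v \<mu>)\<^sup>2 - (dist v m)\<^sup>2 \<le> 2 * \<delta> * dist v \<mu>"
    proof (cases "dist v m \<le> dist v \<mu>")
      case True
      have "(dist v \<mu>)\<^sup>2 - (dist v m)\<^sup>2 = (dist v \<mu> - dist v m) * (dist v \<mu> + dist v m)"
        by (simp add: power2_eq_square algebra_simps)
      also have "\<dots> \<le> \<delta> * (2 * dist v \<mu>)"
        using True tri by (intro mult_mono) auto
      finally show ?thesis by simp
    next
      case False
      then have "(dist v \<mu>)\<^sup>2 \<le> (dist v m)\<^sup>2" by (intro power_mono) auto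
      moreover have "0 \<le> 2 * \<delta> * dist v \<mu>" by (simp add: \<delta>_def)
      ultimately show ?thesis by linarith
    qed
    also have "\<dots> \<le> 2 * \<delta> * R" using that by (intro mult_left_mono) (simp_all add: \<delta>_def)
    finally show ?thesis by simp
  qed
  have "a \<le> (\<integral>\<omega>. (dist (S \<omega>) m)\<^sup>2 + 2 * \<delta> * R \<partial>M)"
    unfolding a_def by (rule integral_mono) (use shift S in auto)
  then have ae: "a \<le> e + 2 * \<delta> * R" by (simp add: e_def prob_space)
  have "b \<le> (\<integral>\<omega>. (dist (X \<omega>) m)\<^sup>2 + 2 * \<delta> * R \<partial>M)"
    unfolding b_def by (rule integral_mono) (use shift X in auto)
  then have bV: "b \<le> V + 2 * \<delta> * R" by (simp add: V_def prob_space)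
  have "b \<le> (\<integral>\<omega>. R\<^sup>2 \<partial>M)"
    unfolding b_def by (rule integral_mono) (use X in \<open>auto intro!: power_mono\<close>)
  then have bR: "b \<le> R\<^sup>2" by (simp add: prob_space)
  have "V + (dist \<mu> m)\<^sup>2 \<le> b"
    unfolding V_def b_def m_def by (rule variance_inequality[OF M sqX])
  then have VR: "V \<le> R\<^sup>2" using bR by (smt (verit) zero_le_power2)
  have Vec: "V + e \<le> c"
    unfolding V_def e_def c_def m_def by (rule variance_inequality_indep[OF M indep S(1) sqS X(1) sqX])
  have "(\<integral>\<omega>. (dist (geodesic_point (S \<omega>) t (X \<omega>)) \<mu>)\<^sup>2 \<partial>M)
      \<le> (\<integral>\<omega>. (1 - t) * (dist (S \<omega>) \<mu>)\<^sup>2 + t * (dist (X \<omega>) \<mu>)\<^sup>2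
            - t * (1 - t) * (dist (S \<omega>) (X \<omega>))\<^sup>2 \<partial>M)"
  proof (rule integral_mono')
    show npc: "(dist (geodesic_point (S \<omega>) t (X \<omega>)) \<mu>)\<^sup>2 \<le> (1 - t) * (dist (S \<omega>) \<mu>)\<^sup>2
        + t * (dist (X \<omega>) \<mu>)\<^sup>2 - t * (1 - t) * (dist (S \<omega>) (X \<omega>))\<^sup>2" for \<omega>
      using geodesic_point_npc[OF t, of \<mu> "S \<omega>" "X \<omega>"] by (simp add: dist_commute[of \<mu>])
    show "0 \<le> (1 - t) * (dist (S \<omega>) \<mu>)\<^sup>2
        + t * (dist (X \<omega>) \<mu>)\<^sup>2 - t * (1 - t) * (dist (S \<omega>) (X \<omega>))\<^sup>2" for \<omega>
      by (rule order_trans[OF zero_le_power2 npc])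
  qed simp_all
  also have "\<dots> = (1 - t) * a + t * b - t * (1 - t) * c"
    by (simp add: a_def b_def c_def)
  also have "\<dots> \<le> (1 - t) * a + t * (V + 2 * \<delta> * R) - t * (1 - t) * (V + (a - 2 * \<delta> * R))"
    using t bV Vec ae by (intro diff_mono add_mono mult_left_mono order_refl) auto
  also have "\<dots> = (1 - t)\<^sup>2 * a + t\<^sup>2 * V + 2 * t * (2 - t) * \<delta> * R"
    by (simp add: power2_eq_square algebra_simps)
  also have "\<dots> \<le> (1 - t)\<^sup>2 * a + t\<^sup>2 * R\<^sup>2 + 2 * t * 2 * \<delta> * R"
    using t VR \<open>0 \<le> R\<close> by (intro add_mono mult_right_mono mult_left_mono order_refl) (auto simp: \<delta>_def)
  finally show ?thesis by (simp add: a_def \<delta>_def m_def mult_ac)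
qed

text \<open>The inductive mean is a function of the first \<open>n\<close> variables. To make it
  measurable on the product space, its arguments are first retracted to the separable closed set in
  which all the variables take their values.\<close>
lemma (in prob_space) indep_var_inductive_mean:
  fixes X :: "nat \<Rightarrow> 'a \<Rightarrow> 'c::hadamard_space"
  assumes indep: "indep_vars (\<lambda>_. borel) X {1..}"
    and D: "countable D" "\<And>n \<omega>. 1 \<le> n \<Longrightarrow> X n \<omega> \<in> closure D"
    and n: "1 \<le> n"
  shows "indep_var borel (\<lambda>\<omega>. inductive_mean (\<lambda>k. X k \<omega>) n) borel (X (Suc n))"
proof -
  define \<rho> where "\<rho> v = (if v \<in> closure D then v else X 1 undefined)" for v
  have \<rho>: "separable_measurable borel \<rho>"
    unfolding \<rho>_def by (rule separable_measurable_retraction) (use D in auto)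
  define Y where "Y x = inductive_mean (\<lambda>k. \<rho> (x k)) n" for x :: "nat \<Rightarrow> 'c"
  have "separable_measurable (PiM {1..n} (\<lambda>_. borel)) Y"
    unfolding Y_def
  proof (rule separable_measurable_inductive_mean[OF _ n])
    fix k assume "1 \<le> k" "k \<le> n"
    then show "separable_measurable (PiM {1..n} (\<lambda>_. borel)) (\<lambda>x. \<rho> (x k))"
      by (intro separable_measurable_comp[OF \<rho>] measurable_component_singleton) simp
  qed
  then have Y: "Y \<in> borel_measurable (PiM {1..n} (\<lambda>_. borel))"
    unfolding separable_measurable_def by blast
  have "indep_var (PiM {1..n} (\<lambda>_. borel)) (\<lambda>\<omega>. restrict (\<lambda>i. X i \<omega>) {1..n})
      (PiM {Suc n} (\<lambda>_. borel)) (\<lambda>\<omega>. restrict (\<lambda>i. X i \<omega>) {Suc n})"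
    by (rule indep_var_restrict[OF indep]) auto
  then have "indep_var borel (Y \<circ> (\<lambda>\<omega>. restrict (\<lambda>i. X i \<omega>) {1..n}))
      borel ((\<lambda>x. x (Suc n)) \<circ> (\<lambda>\<omega>. restrict (\<lambda>i. X i \<omega>) {Suc n}))"
    by (rule indep_var_compose[OF _ Y]) (rule measurable_component_singleton, simp)
  moreover have "Y \<circ> (\<lambda>\<omega>. restrict (\<lambda>i. X i \<omega>) {1..n}) = (\<lambda>\<omega>. inductive_mean (\<lambda>k. X k \<omega>) n)"
    unfolding Y_def comp_def
    by (intro ext inductive_mean_cong[OF _ n]) (auto simp: \<rho>_def D(2))
  moreover have "(\<lambda>x. x (Suc n)) \<circ> (\<lambda>\<omega>. restrict (\<lambda>i. X i \<omega>) {Suc n}) = X (Suc n)"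
    by (auto simp: comp_def)
  ultimately show ?thesis by simp
qed



section \<open>Second moments of the inductive means\<close>

lemma inductive_mean_in_ball:
  assumes "\<And>k. 1 \<le> k \<Longrightarrow> k \<le> n \<Longrightarrow> dist (x k) z \<le> r" and "1 \<le> n"
  shows "dist (inductive_mean x n) z \<le> r"
  using assms(2,1)
proof (induction n rule: dec_induct)
  case base then show ?case by simp
next
  case (step n)
  obtain m where n: "n = Suc m" using step(1) by (cases n) auto
  have "dist (inductive_mean x n) z \<le> r" by (rule step.IH, rule step.prems) auto
  moreover have "dist (x (Suc n)) z \<le> r" by (rule step.prems) auto
  ultimately have "dist (geodesic_point (inductive_mean x n) (1 / real (Suc n)) (x (Suc n))) z \<le> r"
    by (intro geodesic_point_in_ball) simp_all
  then show ?case by (simp add: n)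
qed

lemma inductive_mean_Suc:
  "1 \<le> n \<Longrightarrow> inductive_mean x (Suc n)
    = geodesic_point (inductive_mean x n) (1 / real (Suc n)) (x (Suc n))"
  by (cases n) simp_all

text \<open>With \<open>t = 1 / (n + 1)\<close>, multiplication of the one-step estimate by \<open>(n + 1)\<^sup>2\<close> turns the
  factor \<open>(1 - t)\<^sup>2\<close> into \<open>n\<^sup>2\<close>, so that the recursion telescopes.\<close>
lemma second_moment_inductive_mean:
  fixes X :: "nat \<Rightarrow> 'b \<Rightarrow> 'a::hadamard_space"
  assumes M: "prob_space M" and indep: "prob_space.indep_vars M (\<lambda>_. borel) X {1..}"
    and D: "countable D" "\<And>n \<omega>. 1 \<le> n \<Longrightarrow> X n \<omega> \<in> closure D"
    and R: "mono R" "\<And>n \<omega>. 1 \<le> n \<Longrightarrow> dist (X n \<omega>) \<mu> \<le> R n"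
    and n: "1 \<le> n"
  shows "(real n)\<^sup>2 * (\<integral>\<omega>. (dist (inductive_mean (\<lambda>k. X k \<omega>) n) \<mu>)\<^sup>2 \<partial>M)
    \<le> (\<Sum>k=1..n. 4 * real k * R k * dist (hadamard_expectation M (X k)) \<mu> + (R k)\<^sup>2)"
  using n
proof (induction n rule: dec_induct)
  interpret prob_space M by (rule M)
  have X: "separable_measurable M (X n)" if "1 \<le> n" for n
    using indep that D unfolding separable_measurable_def indep_vars_def by auto
  {
    case base
    have "0 \<le> R 1" using R(2)[of 1] zero_le_dist order_trans by blast
    have "(\<integral>\<omega>. (dist (X 1 \<omega>) \<mu>)\<^sup>2 \<partial>M) \<le> (\<integral>\<omega>. (R 1)\<^sup>2 \<partial>M)"
      by (rule integral_mono') (use R(2)[of 1] in \<open>auto intro!: power_mono\<close>)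
    also have "\<dots> = (R 1)\<^sup>2" by (simp add: prob_space)
    finally show ?case
      using \<open>0 \<le> R 1\<close> by (simp add: add_increasing)
  next
    case (step n)
    define S where "S \<omega> = inductive_mean (\<lambda>k. X k \<omega>) n" for \<omega>
    define r where "r = R (Suc n)"
    define \<delta> where "\<delta> = dist (hadamard_expectation M (X (Suc n))) \<mu>"
    define t where "t = 1 / real (Suc n)"
    have S: "separable_measurable M S"
      unfolding S_def by (rule separable_measurable_inductive_mean[OF X step(1)])
    have Sb: "dist (S \<omega>) \<mu> \<le> r" for \<omega>
      unfolding S_def r_def
    proof (rule inductive_mean_in_ball[OF _ step(1)])
      fix k assume "1 \<le> k" "k \<le> n"
      then have "dist (X k \<omega>) \<mu> \<le> R k" "R k \<le> R (Suc n)" using R by (auto intro: monoD)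
      then show "dist (X k \<omega>) \<mu> \<le> R (Suc n)" by simp
    qed
    have "indep_var borel S borel (X (Suc n))"
      unfolding S_def by (rule indep_var_inductive_mean[OF indep D step(1)])
    then have "(\<integral>\<omega>. (dist (geodesic_point (S \<omega>) t (X (Suc n) \<omega>)) \<mu>)\<^sup>2 \<partial>M)
        \<le> (1 - t)\<^sup>2 * (\<integral>\<omega>. (dist (S \<omega>) \<mu>)\<^sup>2 \<partial>M) + 4 * t * r * \<delta> + t\<^sup>2 * r\<^sup>2"
      unfolding \<delta>_def
      by (rule expected_square_dist_step[OF M _ S Sb X]) (use R(2) in \<open>auto simp: t_def r_def\<close>)
    then have "(real (Suc n))\<^sup>2 * (\<integral>\<omega>. (dist (geodesic_point (S \<omega>) t (X (Suc n) \<omega>)) \<mu>)\<^sup>2 \<partial>M)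
        \<le> (real (Suc n))\<^sup>2 * ((1 - t)\<^sup>2 * (\<integral>\<omega>. (dist (S \<omega>) \<mu>)\<^sup>2 \<partial>M) + 4 * t * r * \<delta> + t\<^sup>2 * r\<^sup>2)"
      by (rule mult_left_mono) simp
    also have "\<dots> = (real (Suc n) * (1 - t))\<^sup>2 * (\<integral>\<omega>. (dist (S \<omega>) \<mu>)\<^sup>2 \<partial>M)
        + 4 * (real (Suc n) * t) * real (Suc n) * r * \<delta> + (real (Suc n) * t)\<^sup>2 * r\<^sup>2"
      by (simp only: power2_eq_square distrib_left) (simp only: mult_ac)
    also have "real (Suc n) * t = 1" by (simp add: t_def)
    also have "real (Suc n) * (1 - t) = real n" by (simp add: t_def field_simps)
    also have "(real n)\<^sup>2 * (\<integral>\<omega>. (dist (S \<omega>) \<mu>)\<^sup>2 \<partial>M)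
      \<le> (\<Sum>k=1..n. 4 * real k * R k * dist (hadamard_expectation M (X k)) \<mu> + (R k)\<^sup>2)"
      unfolding S_def by (rule step.IH)
    finally show ?case
      by (simp add: inductive_mean_Suc[OF step(1)] S_def r_def \<delta>_def t_def)
  }
qed

section \<open>Almost sure convergence along a subsequence\<close>

lemma AE_tendsto_zero_if_summable_integral:
  fixes f :: "nat \<Rightarrow> 'b \<Rightarrow> real"
  assumes int: "\<And>k. integrable M (f k)" and nonneg: "\<And>k \<omega>. 0 \<le> f k \<omega>"
    and sum: "summable (\<lambda>k. \<integral>\<omega>. f k \<omega> \<partial>M)"
  shows "AE \<omega> in M. (\<lambda>k. f k \<omega>) \<longlonglongrightarrow> 0"
proof -
  have [measurable]: "f k \<in> borel_measurable M" for k
    using int by (rule borel_measurable_integrable)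
  have "(\<integral>\<^sup>+\<omega>. (\<Sum>k. ennreal (f k \<omega>)) \<partial>M) = (\<Sum>k. \<integral>\<^sup>+\<omega>. ennreal (f k \<omega>) \<partial>M)"
    by (rule nn_integral_suminf) simp
  also have "\<dots> = (\<Sum>k. ennreal (\<integral>\<omega>. f k \<omega> \<partial>M))"
    by (intro suminf_cong nn_integral_eq_integral int) (simp add: nonneg)
  also have "\<dots> = ennreal (\<Sum>k. \<integral>\<omega>. f k \<omega> \<partial>M)"
    by (rule suminf_ennreal2[OF _ sum]) (simp add: nonneg)
  finally have "(\<integral>\<^sup>+\<omega>. (\<Sum>k. ennreal (f k \<omega>)) \<partial>M) \<noteq> \<infinity>" by simp
  then have "AE \<omega> in M. (\<Sum>k. ennreal (f k \<omega>)) \<noteq> \<infinity>"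
    by (intro nn_integral_PInf_AE) simp_all
  then show ?thesis
  proof eventually_elim
    case (elim \<omega>)
    have "summable (\<lambda>k. f k \<omega>)"
      by (rule summable_suminf_not_top) (use elim nonneg in auto)
    then show ?case by (rule summable_LIMSEQ_zero)
  qed
qed

section \<open>From squares to all indices\<close>

text \<open>The step from \<open>n\<close> to \<open>n + 1\<close> moves the mean by the fraction \<open>1 / (n + 1)\<close> of a distance
  between two points of a common ball.\<close>
lemma dist_inductive_mean_gap:
  assumes b: "mono b" "\<And>k. 1 \<le> k \<Longrightarrow> dist (x k) z \<le> b k" and m: "1 \<le> m"
  shows "dist (inductive_mean x (m + j)) (inductive_mean x m) \<le> real j * (2 * b (m + j) / real m)"
proof (induction j)
  case 0 then show ?case by simp
next
  case (Suc j)
  define n where "n = m + j"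
  have n: "1 \<le> n" "m \<le> n" using m by (auto simp: n_def)
  have ball: "dist (x k) z \<le> b (Suc n)" if "1 \<le> k" "k \<le> Suc n" for k
    using b(2)[OF that(1)] monoD[OF b(1) that(2)] by simp
  have "dist (inductive_mean x n) z \<le> b (Suc n)"
    by (rule inductive_mean_in_ball[OF _ n(1)]) (use ball in auto)
  then have "dist (inductive_mean x n) (x (Suc n)) \<le> 2 * b (Suc n)"
    using ball[of "Suc n"] dist_triangle2[of "inductive_mean x n" "x (Suc n)" z] by simp
  then have "dist (inductive_mean x n) (inductive_mean x (Suc n)) \<le> 1 / real (Suc n) * (2 * b (Suc n))"
    unfolding inductive_mean_Suc[OF n(1)]
    by (subst dist_geodesic_point_left) (auto intro: mult_left_mono divide_right_mono)
  also have "dist (x 1) z \<le> b (Suc n)" by (rule ball) auto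
  then have "0 \<le> b (Suc n)" using zero_le_dist[of "x 1" z] by linarith
  then have "1 / real (Suc n) * (2 * b (Suc n)) \<le> 2 * b (Suc n) / real m"
    using n m by (simp add: frac_le)
  finally have "dist (inductive_mean x (Suc n)) (inductive_mean x n) \<le> 2 * b (Suc n) / real m"
    by (simp add: dist_commute)
  moreover have "real j * (2 * b n / real m) \<le> real j * (2 * b (Suc n) / real m)"
    by (intro mult_left_mono divide_right_mono monoD[OF b(1)]) auto
  moreover have "real (Suc j) * (2 * b (Suc n) / real m)
      = real j * (2 * b (Suc n) / real m) + 2 * b (Suc n) / real m"
    by (simp add: distrib_right add_divide_distrib)
  moreover have "dist (inductive_mean x n) (inductive_mean x m) \<le> real j * (2 * b n / real m)"
    using Suc.IH by (simp add: n_def)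
  ultimately have "dist (inductive_mean x (Suc n)) (inductive_mean x m)
      \<le> real (Suc j) * (2 * b (Suc n) / real m)"
    using dist_triangle[of "inductive_mean x (Suc n)" "inductive_mean x m" "inductive_mean x n"]
    by linarith
  then show ?case by (simp add: n_def)
qed

text \<open>Between \<open>k\<^sup>2\<close> and \<open>(k + 1)\<^sup>2\<close> there are at most \<open>2 * k\<close> steps of length
  \<open>O(k powr (2 * q - 2))\<close>, so the mean moves by \<open>O(k powr (2 * q - 1))\<close>.\<close>
lemma inductive_mean_tendsto_if_squares:
  fixes x :: "nat \<Rightarrow> 'a::hadamard_space"
  assumes q: "0 \<le> q" "q < 1 / 2" and x: "\<And>k. 1 \<le> k \<Longrightarrow> dist (x k) z \<le> C * real k powr q"
    and sq: "(\<lambda>k. inductive_mean x (k\<^sup>2)) \<longlonglongrightarrow> \<mu>"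
  shows "inductive_mean x \<longlonglongrightarrow> \<mu>"
proof -
  have C: "0 \<le> C" using x[of 1] zero_le_dist[of "x 1" z] by (simp del: zero_le_dist)
  define b where "b k = C * real k powr q" for k
  have b: "mono b"
    unfolding b_def using C q by (intro monoI mult_left_mono powr_mono2) auto
  define G where "G k = 4 * C * 4 powr q * real k powr (2 * q - 1)" for k :: nat
  have close: "dist (inductive_mean x n) (inductive_mean x (k\<^sup>2)) \<le> G k"
    if k: "1 \<le> k" "k\<^sup>2 \<le> n" "n < (Suc k)\<^sup>2" for k n
  proof -
    define j where "j = n - k\<^sup>2"
    have n: "n = k\<^sup>2 + j" using k by (simp add: j_def)
    have j: "j \<le> 2 * k" using k(3) by (simp add: n power2_eq_square)
    have "k \<le> k\<^sup>2" using k(1) by (simp add: power2_eq_square)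
    then have "n \<le> 4 * k\<^sup>2" using j n by linarith
    then have "real n \<le> 4 * (real k)\<^sup>2" by (metis of_nat_le_iff of_nat_mult of_nat_numeral of_nat_power)
    then have "real n powr q \<le> (4 * (real k)\<^sup>2) powr q" using q by (intro powr_mono2) auto
    also have "\<dots> = 4 powr q * real k powr (2 * q)"
      using k by (simp add: powr_mult powr_powr flip: powr_numeral)
    finally have bn: "b n \<le> C * (4 powr q * real k powr (2 * q))"
      unfolding b_def using C by (rule mult_left_mono)
    have "dist (inductive_mean x n) (inductive_mean x (k\<^sup>2)) \<le> real j * (2 * b n / real (k\<^sup>2))"
      unfolding n by (rule dist_inductive_mean_gap[OF b]) (use x k in \<open>auto simp: b_def\<close>)
    also have "\<dots> \<le> (2 * real k) * (2 * (C * (4 powr q * real k powr (2 * q))) / real (k\<^sup>2))"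
      using j bn C by (intro mult_mono divide_right_mono mult_left_mono) (auto simp: b_def)
    also have "\<dots> = G k"
      using k by (simp add: G_def powr_diff power2_eq_square)
    finally show ?thesis .
  qed
  have "(\<lambda>k. real k powr (2 * q - 1)) \<longlonglongrightarrow> 0"
    using q by (intro tendsto_neg_powr filterlim_real_sequentially) auto
  then have "G \<longlonglongrightarrow> 4 * C * 4 powr q * 0" unfolding G_def by (intro tendsto_mult tendsto_const)
  moreover have "(\<lambda>k. dist (inductive_mean x (k\<^sup>2)) \<mu>) \<longlonglongrightarrow> 0" using sq by (simp add: tendsto_dist_iff[symmetric])
  ultimately have "(\<lambda>k. G k + dist (inductive_mean x (k\<^sup>2)) \<mu>) \<longlonglongrightarrow> 0"
    using tendsto_add by fastforce
  moreover have fs: "filterlim floor_sqrt at_top sequentially"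
    unfolding filterlim_at_top
    by (auto simp: eventually_sequentially le_floor_sqrt_iff)
  ultimately have lim: "(\<lambda>n. G (floor_sqrt n) + dist (inductive_mean x ((floor_sqrt n)\<^sup>2)) \<mu>) \<longlonglongrightarrow> 0"
    by (rule filterlim_compose)
  have "\<forall>\<^sub>F n in sequentially. dist (inductive_mean x n) \<mu>
      \<le> G (floor_sqrt n) + dist (inductive_mean x ((floor_sqrt n)\<^sup>2)) \<mu>"
    using eventually_ge_at_top[of 1]
  proof eventually_elim
    case (elim n)
    have "dist (inductive_mean x n) (inductive_mean x ((floor_sqrt n)\<^sup>2)) \<le> G (floor_sqrt n)"
      by (rule close) (use elim in \<open>auto simp: Suc_floor_sqrt_power2_gt le_floor_sqrt_iff\<close>)
    then show ?case by (smt (verit) dist_triangle)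
  qed
  then have "(\<lambda>n. dist (inductive_mean x n) \<mu>) \<longlonglongrightarrow> 0"
    by (intro tendsto_sandwich[OF _ _ tendsto_const lim]) simp_all
  then show ?thesis by (simp add: tendsto_dist_iff[symmetric])
qed



section \<open>The strong law\<close>

text \<open>The summands with \<open>\<delta>\<close> add up to at most \<open>4 * n * K * n powr q\<close> times the sum of the
  \<open>\<delta> k\<close>, which is \<open>O(n powr (1 - p))\<close>, and the other summands to at most
  \<open>n * (K * n powr q)\<^sup>2\<close>. Division by \<open>n\<^sup>2\<close> gives the two exponents.\<close>
lemma second_moment_rate:
  fixes e :: "nat \<Rightarrow> real"
  assumes \<delta>: "\<And>k. 0 \<le> \<delta> k"
    and O: "(\<lambda>n. 1 / real n * (\<Sum>k=1..n. \<delta> k)) \<in> O(\<lambda>n. real n powr (- p))"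
    and q: "0 \<le> q" and K: "0 \<le> K"
    and e: "\<And>n. 1 \<le> n \<Longrightarrow> (real n)\<^sup>2 * e n
      \<le> (\<Sum>k=1..n. 4 * real k * (K * real k powr q) * \<delta> k + (K * real k powr q)\<^sup>2)"
  shows "\<exists>A. \<forall>\<^sub>F n in sequentially. e n \<le> A * real n powr (max (q - p) (2 * q - 1))"
proof -
  define r where "r = max (q - p) (2 * q - 1)"
  obtain c where c: "c > 0"
    "\<forall>\<^sub>F n in sequentially. norm (1 / real n * (\<Sum>k=1..n. \<delta> k)) \<le> c * norm (real n powr (- p))"
    using landau_o.bigE[OF O] by blast
  have "\<forall>\<^sub>F n in sequentially. e n \<le> (4 * c * K + K\<^sup>2) * real n powr r"
    using c(2) eventually_ge_at_top[of 1]
  proof eventually_elim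
    case (elim n)
    have n: "0 < real n" "1 \<le> real n" using elim by auto
    define R where "R = K * real n powr q"
    have "1 / real n * (\<Sum>k=1..n. \<delta> k) \<le> c * real n powr (- p)"
      using elim(1) \<delta> by (simp add: sum_nonneg)
    then have \<delta>n: "(\<Sum>k=1..n. \<delta> k) \<le> real n * (c * real n powr (- p))"
      using n by (simp add: field_simps)
    have "(real n)\<^sup>2 * e n
        \<le> (\<Sum>k=1..n. 4 * real k * (K * real k powr q) * \<delta> k + (K * real k powr q)\<^sup>2)"
      by (rule e) (rule elim)
    also have "\<dots> \<le> (\<Sum>k=1..n. 4 * real n * R * \<delta> k + R\<^sup>2)"
    proof (rule sum_mono)
      fix k assume k: "k \<in> {1..n}"
      have "K * real k powr q \<le> R"
        unfolding R_def using k q K by (intro mult_left_mono powr_mono2) auto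
      then show "4 * real k * (K * real k powr q) * \<delta> k + (K * real k powr q)\<^sup>2
          \<le> 4 * real n * R * \<delta> k + R\<^sup>2"
        using k K \<delta> by (intro add_mono mult_mono power_mono) (auto simp: R_def)
    qed
    also have "\<dots> = 4 * real n * R * (\<Sum>k=1..n. \<delta> k) + real n * R\<^sup>2"
      by (simp add: sum.distrib sum_distrib_left)
    also have "\<dots> \<le> 4 * real n * R * (real n * (c * real n powr (- p))) + real n * R\<^sup>2"
      using \<delta>n K by (intro add_mono mult_left_mono order_refl) (auto simp: R_def)
    also have "\<dots> = (real n)\<^sup>2 * (4 * c * K * real n powr (q - p) + K\<^sup>2 * real n powr (2 * q - 1))"
    proof -
      have "2 * q - 1 = q + q - 1" by simp
      then have "real n powr (2 * q - 1) = real n powr q * real n powr q / real n powr 1"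
        by (simp only: powr_diff powr_add)
      also have "real n powr 1 = real n" using n by simp
      finally have e1: "real n powr (2 * q - 1) = real n powr q * real n powr q / real n" .
      have e2: "real n powr (q - p) = real n powr q * real n powr (- p)"
        by (simp only: powr_add[symmetric] diff_conv_add_uminus)
      have "4 * x * (K * w) * (x * (c * v)) + x * (K * w)\<^sup>2
          = x\<^sup>2 * (4 * c * K * (w * v) + K\<^sup>2 * (w * w / x))" if "0 < x" for x v w :: real
        using that by (simp add: power2_eq_square field_simps)
      then show ?thesis using n(1) unfolding e1 e2 R_def by blast
    qed
    also have "\<dots> \<le> (real n)\<^sup>2 * (4 * c * K * real n powr r + K\<^sup>2 * real n powr r)"
      using n c K by (intro mult_left_mono add_mono powr_mono) (auto simp: r_def)
    finally show ?case using n by (simp add: distrib_right)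
  qed
  then show ?thesis unfolding r_def by blast
qed

text \<open>The upper bounds on \<open>q\<close> say exactly that the exponent \<open>max (q - p) (2 * q - 1)\<close> in the
  bound for the second moments is below \<open>- 1 / 2\<close>, that is, that the bound is summable along the
  squares.\<close>
lemma inductive_mean_converges_bounded:
  fixes X :: "nat \<Rightarrow> 'b \<Rightarrow> 'a::hadamard_space" and \<mu> :: 'a
  assumes M: "prob_space M" and indep: "prob_space.indep_vars M (\<lambda>_. borel) X {1..}"
    and D: "countable D" "\<And>n \<omega>. 1 \<le> n \<Longrightarrow> X n \<omega> \<in> closure D"
    and bound: "\<And>n \<omega>. 1 \<le> n \<Longrightarrow> dist (X n \<omega>) z \<le> C * real n powr q"
    and O: "(\<lambda>n. 1 / real n * (\<Sum>k=1..n. dist (hadamard_expectation M (X k)) \<mu>))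
      \<in> O(\<lambda>n. real n powr (- p))"
    and C: "C > 0" and q: "0 \<le> q" "q < 1 / 4" "q < p - 1 / 2"
  shows "AE \<omega> in M. (\<lambda>n. inductive_mean (\<lambda>k. X k \<omega>) n) \<longlonglongrightarrow> \<mu>"
proof -
  interpret prob_space M by (rule M)
  \<comment> \<open>the factor \<open>n powr q\<close> is at least 1 for \<open>n \<ge> 1\<close>, so it absorbs the distance from \<open>z\<close> to \<open>\<mu>\<close>\<close>
  define K where "K = C + dist z \<mu>"
  have K: "0 \<le> K" using C by (simp add: K_def)
  define R where "R k = K * real k powr q" for k
  have R: "mono R"
    unfolding R_def using K q by (intro monoI mult_left_mono powr_mono2) auto
  have XR: "dist (X n \<omega>) \<mu> \<le> R n" if "1 \<le> n" for n \<omega>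
  proof -
    have "1 \<le> real n powr q" using that q by (simp add: ge_one_powr_ge_zero)
    then have "dist z \<mu> * 1 \<le> dist z \<mu> * real n powr q" by (intro mult_left_mono) auto
    then show ?thesis
      using bound[OF that, of \<omega>] dist_triangle[of "X n \<omega>" \<mu> z]
      unfolding R_def K_def distrib_right by linarith
  qed
  define S where "S n \<omega> = inductive_mean (\<lambda>k. X k \<omega>) n" for n \<omega>
  define e where "e n = (\<integral>\<omega>. (dist (S n \<omega>) \<mu>)\<^sup>2 \<partial>M)" for n
  have int: "integrable M (\<lambda>\<omega>. (dist (S n \<omega>) \<mu>)\<^sup>2)" if "1 \<le> n" for n
  proof -
    have "separable_measurable M (S n)"
      unfolding S_def
    proof (rule separable_measurable_inductive_mean[OF _ that])
      fix k :: nat assume "1 \<le> k"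
      with indep D show "separable_measurable M (X k)"
        unfolding separable_measurable_def indep_vars_def by auto
    qed
    moreover have "dist (S n \<omega>) \<mu> \<le> R n" for \<omega>
      unfolding S_def
    proof (rule inductive_mean_in_ball[OF _ that])
      fix k assume "1 \<le> k" "k \<le> n"
      then have "dist (X k \<omega>) \<mu> \<le> R k" "R k \<le> R n" using XR R by (auto intro: monoD)
      then show "dist (X k \<omega>) \<mu> \<le> R n" by simp
    qed
    ultimately have "square_integrable M (S n)"
      unfolding separable_measurable_def by (intro square_integrable_bounded[OF M]) auto
    then show ?thesis by (rule square_integrable_dist[OF M])
  qed
  define r where "r = max (q - p) (2 * q - 1)"
  have r: "2 * r < - 1" using q unfolding r_def by (simp add: max_def)
  have "\<exists>A. \<forall>\<^sub>F n in sequentially. e n \<le> A * real n powr r"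
    unfolding r_def
  proof (rule second_moment_rate[OF _ O q(1) K])
    fix n :: nat assume n: "1 \<le> n"
    show "(real n)\<^sup>2 * e n \<le> (\<Sum>k=1..n. 4 * real k * (K * real k powr q)
        * dist (hadamard_expectation M (X k)) \<mu> + (K * real k powr q)\<^sup>2)"
      using second_moment_inductive_mean[OF M indep D R XR n] unfolding e_def S_def R_def .
  qed simp
  then obtain A where A: "\<forall>\<^sub>F n in sequentially. e n \<le> A * real n powr r" by blast
  have sq: "filterlim (\<lambda>k. (Suc k)\<^sup>2) at_top sequentially"
    by (rule filterlim_subseq) (auto simp: strict_mono_def intro!: power_strict_mono)
  have "summable (\<lambda>k. e ((Suc k)\<^sup>2))"
  proof (rule summable_comparison_test_ev)
    show "\<forall>\<^sub>F k in sequentially. norm (e ((Suc k)\<^sup>2)) \<le> A * real (Suc k) powr (2 * r)"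
      using eventually_compose_filterlim[OF A sq]
    proof eventually_elim
      case (elim k)
      have "real ((Suc k)\<^sup>2) powr r = (real (Suc k) powr 2) powr r"
        by (simp only: powr_numeral of_nat_power)
      also have "\<dots> = real (Suc k) powr (2 * r)" by (rule powr_powr)
      finally have "real ((Suc k)\<^sup>2) powr r = real (Suc k) powr (2 * r)" .
      moreover have "0 \<le> e ((Suc k)\<^sup>2)" by (simp add: e_def)
      ultimately show ?case using elim by simp
    qed
    have "summable (\<lambda>k. real k powr (2 * r))" using r by (simp add: summable_real_powr_iff)
    then show "summable (\<lambda>k. A * real (Suc k) powr (2 * r))"
      by (intro summable_mult) (simp only: summable_Suc_iff[of "\<lambda>k. real k powr (2 * r)"])
  qed
  then have "AE \<omega> in M. (\<lambda>k. (dist (S ((Suc k)\<^sup>2) \<omega>) \<mu>)\<^sup>2) \<longlonglongrightarrow> 0"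
    unfolding e_def by (intro AE_tendsto_zero_if_summable_integral int) auto
  then show ?thesis
  proof eventually_elim
    case (elim \<omega>)
    have "(\<lambda>k. sqrt ((dist (S ((Suc k)\<^sup>2) \<omega>) \<mu>)\<^sup>2)) \<longlonglongrightarrow> sqrt 0"
      by (rule tendsto_real_sqrt[OF elim])
    then have "(\<lambda>k. dist (S ((Suc k)\<^sup>2) \<omega>) \<mu>) \<longlonglongrightarrow> 0" by simp
    then have "(\<lambda>k. S ((Suc k)\<^sup>2) \<omega>) \<longlonglongrightarrow> \<mu>" by (rule tendsto_dist_iff[THEN iffD2])
    then have squares: "(\<lambda>k. S (k\<^sup>2) \<omega>) \<longlonglongrightarrow> \<mu>" by (rule LIMSEQ_imp_Suc)
    show ?case
      by (rule inductive_mean_tendsto_if_squares[OF q(1) _ bound squares[unfolded S_def]])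
        (use q in auto)
  qed
qed

lemma hadamard_expectation_cong_AE:
  assumes "X \<in> borel_measurable M" "Y \<in> borel_measurable M" and eq: "AE \<omega> in M. X \<omega> = Y \<omega>"
  shows "hadamard_expectation M X = hadamard_expectation M Y"
proof -
  have "(\<integral>\<omega>. (dist (X \<omega>) w)\<^sup>2 \<partial>M) = (\<integral>\<omega>. (dist (Y \<omega>) w)\<^sup>2 \<partial>M)" for w
  proof (rule integral_cong_AE)
    have "continuous_on UNIV (\<lambda>v. (dist v w)\<^sup>2)" by (intro continuous_intros)
    then show "(\<lambda>\<omega>. (dist (X \<omega>) w)\<^sup>2) \<in> borel_measurable M"
      "(\<lambda>\<omega>. (dist (Y \<omega>) w)\<^sup>2) \<in> borel_measurable M"
      using assms by (auto intro: borel_measurable_continuous_on)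
    show "AE \<omega> in M. (dist (X \<omega>) w)\<^sup>2 = (dist (Y \<omega>) w)\<^sup>2" using eq by eventually_elim simp
  qed
  then show ?thesis by (simp add: hadamard_expectation_def)
qed

theorem corollary2:
  fixes M :: "'b measure"
    and X :: "nat \<Rightarrow> 'b \<Rightarrow> 'a::hadamard_space"
    and \<mu>s :: "nat \<Rightarrow> 'a" and \<mu> z :: 'a
    and p q C :: real
  assumes "prob_space M"
    and "prob_space.indep_vars M (\<lambda>_. borel) X {1..}"
    and "\<And>n. n \<ge> 1 \<Longrightarrow> separably_valued M (X n)"
    and "\<And>n. n \<ge> 1 \<Longrightarrow> square_integrable M (X n)"
    and "\<And>n. n \<ge> 1 \<Longrightarrow> hadamard_expectation M (X n) = \<mu>s n"
    and "p > 1 / 2"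
    and "(\<lambda>n. 1 / real n * (\<Sum>k=1..n. dist (\<mu>s k) \<mu>)) \<in> O(\<lambda>n. real n powr (- p))"
    and "C > 0" and "0 \<le> q" and "q < min (1 / 4) (p - 1 / 2)"
    and "\<And>n. n \<ge> 1 \<Longrightarrow>
      \<P>(\<omega> in M. (MAX k\<in>{1..n}. dist (X k \<omega>) z) \<le> C * real n powr q) = 1"
  shows "AE \<omega> in M. (\<lambda>n. inductive_mean (\<lambda>k. X k \<omega>) n) \<longlonglongrightarrow> \<mu>"
proof -
  interpret prob_space M by fact
  have X: "X n \<in> borel_measurable M" if "1 \<le> n" for n
    using assms(4)[OF that] unfolding square_integrable_def by blast
  have "\<exists>E. countable E \<and> (AE \<omega> in M. X n \<omega> \<in> closure E)" if "1 \<le> n" for n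
    using assms(3)[OF that] unfolding separably_valued_def .
  then obtain E where E: "\<And>n. 1 \<le> n \<Longrightarrow> countable (E n)"
    "\<And>n. 1 \<le> n \<Longrightarrow> AE \<omega> in M. X n \<omega> \<in> closure (E n)" by metis
  define D where "D = (\<Union>n\<in>{1..}. E n)"
  have D: "countable D" unfolding D_def using E(1) by (intro countable_UN) auto
  \<comment> \<open>Replacing each variable on a null set makes the bound and the separability hold everywhere;
      independence survives because the replacement is a Borel function of the variable.\<close>
  define A where "A n = closure D \<inter> cball z (C * real n powr q)" for n
  have clA: "closed (A n)" for n unfolding A_def by (intro closed_Int closed_closure closed_cball)
  have XA: "AE \<omega> in M. X n \<omega> \<in> A n" if n: "1 \<le> n" for n
  proof -
    have "AE \<omega> in M. \<omega> \<in> {\<omega> \<in> space M. (MAX k\<in>{1..n}. dist (X k \<omega>) z) \<le> C * real n powr q}"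
      by (rule AE_prob_1[OF assms(11)[OF n]])
    then show ?thesis
      using E(2)[OF n]
    proof eventually_elim
      case (elim \<omega>)
      have "dist (X n \<omega>) z \<le> (MAX k\<in>{1..n}. dist (X k \<omega>) z)"
        using n by (intro Max_ge) auto
      also have "\<dots> \<le> C * real n powr q" using elim(1) by blast
      finally have "X n \<omega> \<in> cball z (C * real n powr q)" by (simp add: dist_commute)
      moreover have "closure (E n) \<subseteq> closure D" using n by (intro closure_mono) (auto simp: D_def)
      ultimately show ?case using elim(2) by (auto simp: A_def)
    qed
  qed
  have "\<exists>a. a \<in> A n" if "1 \<le> n" for n
  proof (rule ccontr)
    assume "\<nexists>a. a \<in> A n"
    then have "AE \<omega> in M. False" using XA[OF that] by simp
    then show False by simp
  qed
  then obtain a where a: "\<And>n. 1 \<le> n \<Longrightarrow> a n \<in> A n" by metis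
  define Y where "Y n \<omega> = (if X n \<omega> \<in> A n then X n \<omega> else a n)" for n \<omega>
  have YA: "Y n \<omega> \<in> A n" if "1 \<le> n" for n \<omega> using a[OF that] by (simp add: Y_def)
  have retract: "(\<lambda>x. if x \<in> A n then x else a n) \<in> borel_measurable borel" for n
    by (rule measurable_retraction_closed[OF clA])
  have Y: "indep_vars (\<lambda>_. borel) Y {1..}"
    unfolding Y_def by (rule indep_vars_compose2[OF assms(2) retract])
  have YX: "AE \<omega> in M. X n \<omega> = Y n \<omega>" if "1 \<le> n" for n
    using XA[OF that] by eventually_elim (simp add: Y_def)
  have Y\<mu>: "hadamard_expectation M (Y n) = \<mu>s n" if "1 \<le> n" for n
  proof -
    have "Y n \<in> borel_measurable M" using Y that by (simp add: indep_vars_def)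
    then have "hadamard_expectation M (X n) = hadamard_expectation M (Y n)"
      by (rule hadamard_expectation_cong_AE[OF X[OF that] _ YX[OF that]])
    then show ?thesis using assms(5)[OF that] by simp
  qed
  have "(\<lambda>n. 1 / real n * (\<Sum>k=1..n. dist (hadamard_expectation M (Y k)) \<mu>))
      = (\<lambda>n. 1 / real n * (\<Sum>k=1..n. dist (\<mu>s k) \<mu>))"
    by (intro ext arg_cong2[of _ _ _ _ "(*)"] sum.cong refl) (simp add: Y\<mu>)
  then have rate: "(\<lambda>n. 1 / real n * (\<Sum>k=1..n. dist (hadamard_expectation M (Y k)) \<mu>))
      \<in> O(\<lambda>n. real n powr (- p))" using assms(7) by (simp only:)
  have conv: "AE \<omega> in M. (\<lambda>n. inductive_mean (\<lambda>k. Y k \<omega>) n) \<longlonglongrightarrow> \<mu>"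
    by (rule inductive_mean_converges_bounded[OF assms(1) Y D _ _ rate assms(8,9)])
      (use YA assms(10) in \<open>auto simp: A_def dist_commute\<close>)
  have "AE \<omega> in M. \<forall>n\<in>{1..}. X n \<omega> = Y n \<omega>"
    using YX by (subst AE_ball_countable) auto
  with conv show ?thesis
  proof eventually_elim
    case (elim \<omega>)
    have "\<forall>\<^sub>F n in sequentially. inductive_mean (\<lambda>k. Y k \<omega>) n = inductive_mean (\<lambda>k. X k \<omega>) n"
      using eventually_ge_at_top[of 1]
      by eventually_elim (use elim(2) in \<open>auto intro!: inductive_mean_cong\<close>)
    then show ?case using elim(1) by (rule Lim_transform_eventually[rotated])
  qed
qed

end
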